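(* Let $g,d,n$ be positive integers, let $A\in SM_d(\mathbb{R})^g$, let $\mathcal{D}_A$ be the associated free spectrahedron, and let $X\in\mathcal{D}_A(n)$. Write $k_{A,X}:=\dim\ker L_A(X)$. Then: (1) If $X$ is a Euclidean extreme point of $\mathcal{D}_A$, then $\frac{g(n+1)}{2}\le d\,k_{A,X}$. (2) If $\mathcal{D}_A$ is a free polytope and $X$ is a Euclidean extreme point of $\mathcal{D}_A$, then $\frac{g(n+1)}{2}\le k_{A,X}$. (3) Suppose $A$ is unitarily equivalent to $\bigoplus_{j=1}^{\ell}A^j$, where $A^j\in SM_{d_j}(\mathbb{R})^g$ for each $j$, and set $k^j_{A,X}:=\dim\ker L_{A^j}(X)$ for $j=1,\dots,\ell$. If $X$ is a Euclidean extreme point of $\mathcal{D}_A$, then $$\frac{g(n+1)}{2}\le\sum_{j=1}^{\ell}d_j\,k^j_{A,X}.$$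
   Context: $SM_n(\mathbb{R})^g$ denotes the set of $g$-tuples $X=(X_1,\dots,X_g)$ of real symmetric $n\times n$ matrices. For $A\in SM_d(\mathbb{R})^g$ and $X\in SM_n(\mathbb{R})^g$, set $L_A(X):=I_{dn}-A_1\otimes X_1-\dots-A_g\otimes X_g$ (Kronecker products). The free spectrahedron of $A$ at level $n$ is $\mathcal{D}_A(n):=\{X\in SM_n(\mathbb{R})^g: L_A(X)\succeq0\}$, and $\mathcal{D}_A:=\bigcup_{n\ge1}\mathcal{D}_A(n)$. A tuple $A$ is called a defining tuple for $\mathcal{D}_A$. A defining tuple $A\in SM_d(\mathbb{R})^g$ is minimal if every $B\in SM_{d'}(\mathbb{R})^g$ with $\mathcal{D}_B=\mathcal{D}_A$ satisfies $d\le d'$. Tuples $X,Y\in SM_n(\mathbb{R})^g$ are unitarily equivalent if there is a real orthogonal matrix $U$ with $U^TX_iU=Y_i$ for all $i$. Direct sums of tuples are taken entrywise. $\mathcal{D}_A$ is a free polytope if a minimal defining tuple for it is simultaneously diagonalizable, i.e. unitarily equivalent to a tuple of diagonal matrices. $X\in\mathcal{D}_A(n)$ is a Euclidean extreme point of $\mathcal{D}_A$ if $X$ is a classical extreme point of the convex set $\mathcal{D}_A(n)$, i.e. $X$ is not a nontrivial convex combination of elements of $\mathcal{D}_A(n)$. *)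

theory Defs
  imports Complex_Main "Jordan_Normal_Form.Matrix_Kernel"
begin

definition kron :: "real mat \<Rightarrow> real mat \<Rightarrow> real mat" where
  "kron A B = mat (dim_row A * dim_row B) (dim_col A * dim_col B)
     (\<lambda>(i, j). A $$ (i div dim_row B, j div dim_col B) * B $$ (i mod dim_row B, j mod dim_col B))"

definition psd :: "real mat \<Rightarrow> bool" where
  "psd M \<longleftrightarrow> square_mat M \<and> M\<^sup>T = M \<and> (\<forall>v \<in> carrier_vec (dim_row M). v \<bullet> (M *\<^sub>v v) \<ge> 0)"

text \<open>A tuple of matrices is the list of its entries; they are indexed from 0.
  \<open>SM g n\<close> is the set of \<open>g\<close>-tuples of real symmetric \<open>n\<close> by \<open>n\<close> matrices.\<close>

type_synonym tuple = "real mat list"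

definition SM :: "nat \<Rightarrow> nat \<Rightarrow> tuple set" where
  "SM g n = {X. length X = g \<and> (\<forall>M \<in> set X. M \<in> carrier_mat n n \<and> M\<^sup>T = M)}"

text \<open>For \<open>A \<in> SM g d\<close> and \<open>X \<in> SM g n\<close>, the sizes \<open>d\<close> and \<open>n\<close> are passed explicitly to
  fix the size of the identity matrix.\<close>

definition pencil :: "nat \<Rightarrow> nat \<Rightarrow> tuple \<Rightarrow> tuple \<Rightarrow> real mat" where
  "pencil d n A X = foldl (\<lambda>M (a, x). M - kron a x) (1\<^sub>m (d * n)) (zip A X)"

definition free_spec_level :: "nat \<Rightarrow> nat \<Rightarrow> tuple \<Rightarrow> nat \<Rightarrow> tuple set" where
  "free_spec_level g d A n = {X \<in> SM g n. psd (pencil d n A X)}"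

definition free_spec :: "nat \<Rightarrow> nat \<Rightarrow> tuple \<Rightarrow> tuple set" where
  "free_spec g d A = (\<Union>n \<in> {1..}. free_spec_level g d A n)"

text \<open>Sizes of defining tuples are positive.\<close>

definition minimal_defining :: "nat \<Rightarrow> nat \<Rightarrow> tuple \<Rightarrow> bool" where
  "minimal_defining g d A \<longleftrightarrow> d \<ge> 1 \<and> A \<in> SM g d \<and>
     (\<forall>d' \<ge> 1. \<forall>B \<in> SM g d'. free_spec g d' B = free_spec g d A \<longrightarrow> d \<le> d')"

definition unitarily_equiv :: "nat \<Rightarrow> nat \<Rightarrow> tuple \<Rightarrow> tuple \<Rightarrow> bool" where
  "unitarily_equiv g n X Y \<longleftrightarrow> X \<in> SM g n \<and> Y \<in> SM g n \<and>
     (\<exists>U \<in> carrier_mat n n. U\<^sup>T * U = 1\<^sub>m n \<and> (\<forall>i<g. U\<^sup>T * (X ! i) * U = Y ! i))"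

definition simult_diagonalizable :: "nat \<Rightarrow> nat \<Rightarrow> tuple \<Rightarrow> bool" where
  "simult_diagonalizable g n X \<longleftrightarrow>
     (\<exists>D. unitarily_equiv g n X D \<and> (\<forall>M \<in> set D. diagonal_mat M))"

definition is_free_polytope :: "nat \<Rightarrow> tuple set \<Rightarrow> bool" where
  "is_free_polytope g S \<longleftrightarrow>
     (\<exists>d B. minimal_defining g d B \<and> free_spec g d B = S \<and> simult_diagonalizable g d B)"

definition tuple_direct_sum :: "nat \<Rightarrow> nat \<Rightarrow> (nat \<Rightarrow> tuple) \<Rightarrow> tuple" where
  "tuple_direct_sum g l As = map (\<lambda>i. diag_block_mat (map (\<lambda>j. As j ! i) [0..<l])) [0..<g]"

definition convex_comb :: "real \<Rightarrow> tuple \<Rightarrow> tuple \<Rightarrow> tuple" where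
  "convex_comb t Y Z = map2 (\<lambda>y z. t \<cdot>\<^sub>m y + (1 - t) \<cdot>\<^sub>m z) Y Z"

text \<open>Tuples do not form a type of class \<open>real_vector\<close>, so extreme points are defined
  directly; compare \<open>extreme_point_of\<close> in HOL-Analysis.\<close>

definition euclidean_extreme :: "nat \<Rightarrow> nat \<Rightarrow> tuple \<Rightarrow> nat \<Rightarrow> tuple \<Rightarrow> bool" where
  "euclidean_extreme g d A n X \<longleftrightarrow> X \<in> free_spec_level g d A n \<and>
     \<not> (\<exists>Y \<in> free_spec_level g d A n. \<exists>Z \<in> free_spec_level g d A n. \<exists>t.
          0 < t \<and> t < 1 \<and> Y \<noteq> Z \<and> X = convex_comb t Y Z)"

end

theory Submission
  imports Defs
begin

text \<open>Let \<open>X\<close> be a Euclidean extreme point at level \<open>n\<close>. If a symmetric tuple \<open>B\<close> is such that the linear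
part of the pencil at \<open>B\<close> vanishes on the kernel of \<open>L\<^sub>A(X)\<close>, then \<open>L\<^sub>A(X + t B)\<close> and \<open>L\<^sub>A(X - t B)\<close> stay
positive semidefinite for small \<open>t\<close> (\<open>psd_perturbation\<close>), so \<open>B\<close> is zero. The condition on \<open>B\<close> is a
homogeneous linear system with \<open>d n k\<close> equations, where \<open>k\<close> is the dimension of the kernel, in
\<open>g n (n + 1) / 2\<close> unknowns. Having only the zero solution, it has at least as many equations as unknowns.

The same argument works with any finite family of tuples whose free spectrahedra intersect, at level \<open>n\<close>,
inside that of \<open>A\<close>; it is carried out in this generality in \<open>extreme_point_equation_count\<close>. The family
consisting of \<open>A\<close> alone gives the first claim. If \<open>A\<close> is unitarily equivalent to a direct sum, then its
free spectrahedron is the intersection of those of the summands (\<open>psd_pencil_direct_sum\<close>), and the family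
of summands gives the third claim.

For a free polytope, some tuple with the same free spectrahedron as \<open>A\<close> is unitarily equivalent to a
diagonal one. A diagonal tuple is a direct sum of scalar tuples, so the free spectrahedron is
described by finitely many linear inequalities \<open>\<Sum>\<^sub>i b\<^sub>j\<^sub>i X\<^sub>i \<le> I\<close>, and the family of these scalar tuples bounds
\<open>g (n + 1) / 2\<close> by the sum over \<open>j\<close> of the dimensions of the kernels of \<open>I - \<Sum>\<^sub>i b\<^sub>j\<^sub>i X\<^sub>i\<close>. It remains to
compare this sum with the kernel of \<open>L\<^sub>A(X)\<close>. After discarding redundant inequalities, every
\<open>b\<^sub>j\<close> has a point on its facet and strictly inside all others (\<open>irredundant_scalar_description\<close>); there the
pencil of \<open>A\<close> is singular, and moving the point within the facet shows that \<open>A\<close> has a joint eigenvector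
\<open>v\<^sub>j\<close> with eigenvalues \<open>b\<^sub>j\<^sub>i\<close> (\<open>facet_gives_joint_eigenvector\<close>). These vectors are orthogonal, and tensoring
\<open>v\<^sub>j\<close> with the kernel of the \<open>j\<close>-th scalar pencil embeds the direct sum of these kernels into the kernel
of \<open>L\<^sub>A(X)\<close> (\<open>sum_scalar_kernel_dims_le\<close>).\<close>

section \<open>Homogeneous linear systems and kernel dimensions\<close>

text \<open>Induction on the equations: an equation with a nonzero coefficient at the unknown \<open>p\<close> is solved for
\<open>p\<close> and substituted into the others, which uses up one equation and one unknown.\<close>
lemma homogeneous_system_nontrivial:
  fixes a :: "'e \<Rightarrow> 'v \<Rightarrow> real"
  assumes "finite E" "finite V" "card E < card V"
  shows "\<exists>x. (\<forall>e\<in>E. (\<Sum>v\<in>V. a e v * x v) = 0) \<and> (\<exists>v\<in>V. x v \<noteq> 0)"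
  using assms
proof (induction E arbitrary: V a rule: finite_induct)
  case empty
  then obtain v where "v \<in> V" by fastforce
  then show ?case by (intro exI[of _ "\<lambda>_. 1"]) auto
next
  case (insert e E)
  show ?case
  proof (cases "\<forall>v\<in>V. a e v = 0")
    case True
    have "card E < card V" using insert by simp
    from insert.IH[OF insert.prems(1) this, of a] True show ?thesis by auto
  next
    case False
    then obtain p where p: "p \<in> V" "a e p \<noteq> 0" by auto
    define V' where "V' = V - {p}"
    define b where "b = (\<lambda>e' v. a e' v - a e' p * a e v / a e p)"
    have V: "V = insert p V'" "p \<notin> V'" "finite V'" using p insert.prems V'_def by auto
    have "card E < card V'" using insert V by simp
    from insert.IH[OF V(3) this, of b] obtain x where
      x: "\<forall>e'\<in>E. (\<Sum>v\<in>V'. b e' v * x v) = 0" "\<exists>v\<in>V'. x v \<noteq> 0" by blast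
    define S where "S = (\<Sum>v\<in>V'. a e v * x v)"
    define y where "y = x(p := - S / a e p)"
    have sums: "(\<Sum>v\<in>V. a e' v * y v) = (\<Sum>v\<in>V'. a e' v * x v) - a e' p * S / a e p" for e'
    proof -
      have "(\<Sum>v\<in>V'. a e' v * y v) = (\<Sum>v\<in>V'. a e' v * x v)"
        using V(2) by (intro sum.cong) (auto simp: y_def)
      then show ?thesis using V by (simp add: y_def)
    qed
    have "(\<Sum>v\<in>V. a e v * y v) = 0" using p sums[of e] by (simp add: S_def)
    moreover have "(\<Sum>v\<in>V. a e' v * y v) = 0" if "e' \<in> E" for e'
    proof -
      have "(\<Sum>v\<in>V'. b e' v * x v) = (\<Sum>v\<in>V'. a e' v * x v - a e' p / a e p * (a e v * x v))"
        unfolding b_def by (intro sum.cong) (auto simp: algebra_simps)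
      also have "\<dots> = (\<Sum>v\<in>V'. a e' v * x v) - a e' p / a e p * S"
        by (simp add: sum_subtractf sum_distrib_left S_def)
      finally show ?thesis using x(1) that sums[of e'] by simp
    qed
    moreover have "\<exists>v\<in>V. y v \<noteq> 0" using x(2) V by (auto simp: y_def)
    ultimately show ?thesis by (intro exI[of _ y]) auto
  qed
qed

text \<open>The same count for systems whose coefficients are not collected: each equation is a sum of terms
indexed by \<open>K e\<close>, and several terms may refer to the same unknown through \<open>\<phi> e\<close>. For the entries of
symmetric matrices this happens because the positions \<open>(p, q)\<close> and \<open>(q, p)\<close> share one unknown.\<close>
lemma homogeneous_system_nontrivial_reindexed:
  fixes a :: "'e \<Rightarrow> 'k \<Rightarrow> real" and \<phi> :: "'e \<Rightarrow> 'k \<Rightarrow> 'v"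
  assumes "finite E" "finite V" "card E < card V" "\<And>e. finite (K e)" "\<And>e. e \<in> E \<Longrightarrow> \<phi> e ` K e \<subseteq> V"
  shows "\<exists>x. (\<forall>e\<in>E. (\<Sum>k\<in>K e. a e k * x (\<phi> e k)) = 0) \<and> (\<exists>v\<in>V. x v \<noteq> 0)"
proof -
  obtain x where x: "\<forall>e\<in>E. (\<Sum>v\<in>V. (\<Sum>k\<in>{k\<in>K e. \<phi> e k = v}. a e k) * x v) = 0" "\<exists>v\<in>V. x v \<noteq> 0"
    using homogeneous_system_nontrivial[OF assms(1-3), of "\<lambda>e v. \<Sum>k\<in>{k\<in>K e. \<phi> e k = v}. a e k"] by blast
  have "(\<Sum>k\<in>K e. a e k * x (\<phi> e k)) = (\<Sum>v\<in>V. (\<Sum>k\<in>{k\<in>K e. \<phi> e k = v}. a e k) * x v)" if "e \<in> E" for e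
    by (subst sum.group[OF assms(4,2) assms(5)[OF that], symmetric]) (auto simp: sum_distrib_right intro!: sum.cong)
  with x show ?thesis by (intro exI[of _ x]) simp
qed

text \<open>A basis of the kernel in coordinates. Row reduction leaves the kernel unchanged, and the kernel of
a matrix in echelon form has an explicit finite basis.\<close>
lemma kernel_basis:
  fixes M :: "real mat"
  assumes M: "M \<in> carrier_mat nr nc"
  shows "\<exists>W. finite W \<and> card W = kernel_dim M \<and> W \<subseteq> mat_kernel M \<and>
    (\<forall>u\<in>mat_kernel M. \<exists>c. \<forall>r<nc. u $ r = (\<Sum>w\<in>W. c w * w $ r)) \<and>
    (\<forall>c. (\<forall>r<nc. (\<Sum>w\<in>W. c w * w $ r) = 0) \<longrightarrow> (\<forall>w\<in>W. c w = 0))"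
proof -
  let ?B = "gauss_jordan_single M"
  from gauss_jordan_single[OF M refl]
  obtain P Q where AB: "?B = P * M" and QP: "Q * P = 1\<^sub>m nr" and
    P: "P \<in> carrier_mat nr nr" and Q: "Q \<in> carrier_mat nr nr" and B: "?B \<in> carrier_mat nr nc" 
    and row: "row_echelon_form ?B" by auto
  interpret K: kernel nr nc ?B
    by (unfold_locales, rule B)
  have eq: "mat_kernel ?B = mat_kernel M"
    using mat_kernel_mult_eq[OF M P Q QP, folded AB] .
  have dim: "kernel_dim M = K.dim" unfolding kernel_dim_def using M eq by simp
  define W where "W = set (find_base_vectors ?B)"
  have b: "K.basis W" using find_base_vectors[OF row B] W_def by auto
  have sub: "W \<subseteq> mat_kernel ?B" using find_base_vectors[OF row B] W_def by auto
  have fin: "finite W" by (simp add: W_def)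
  have card: "card W = kernel_dim M" using K.Ker.dim_basis[OF fin b] dim by simp
  have span: "\<exists>c. \<forall>r<nc. u $ r = (\<Sum>w\<in>W. c w * w $ r)" if "u \<in> mat_kernel M" for u
  proof -
    from that b eq have "u \<in> K.span W" unfolding K.Ker.basis_def by auto
    then obtain c where "u = K.lincomb c W" 
      using K.Ker.finite_in_span[OF fin] sub by auto
    then show ?thesis using K.lincomb_index[OF _ sub] by auto
  qed
  have indep: "\<forall>w\<in>W. c w = 0" if "\<forall>r<nc. (\<Sum>w\<in>W. c w * w $ r) = 0" for c
  proof (rule ccontr)
    assume "\<not> ?thesis"
    then obtain w where w: "w \<in> W" "c w \<noteq> 0" by auto
    have "K.lincomb c W \<in> mat_kernel ?B" using sub by (intro K.Ker.lincomb_closed) auto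
    then have "dim_vec (K.lincomb c W) = nc" using mat_kernelD(1)[OF B] by auto
    then have "K.lincomb c W = 0\<^sub>v nc" using that K.lincomb_index[OF _ sub]
      by (intro eq_vecI) auto
    then have "K.lin_dep W" unfolding K.Ker.lin_dep_def using w fin 
      by (intro exI[of _ W] exI[of _ c] exI[of _ w]) auto
    then show False using b unfolding K.Ker.basis_def by auto
  qed
  show ?thesis using fin card sub[unfolded eq] span indep by (intro exI[of _ W]) simp
qed

text \<open>If there were more vectors than \<open>kernel_dim M\<close>, their coefficients with respect to a basis of the
kernel would give a homogeneous system with more unknowns than equations, and hence a nontrivial
linear relation.\<close>
lemma independent_family_card_le_kernel_dim:
  fixes M :: "real mat"
  assumes M: "M \<in> carrier_mat nr nc" and I: "finite I" and ker: "\<And>i. i \<in> I \<Longrightarrow> w i \<in> mat_kernel M"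
    and indep: "\<And>c. \<forall>r<nc. (\<Sum>i\<in>I. c i * w i $ r) = 0 \<Longrightarrow> \<forall>i\<in>I. c i = 0"
  shows "card I \<le> kernel_dim M"
proof (rule ccontr)
  assume neg: "\<not> ?thesis"
  obtain W where W: "finite W" "card W = kernel_dim M"
    "\<And>u. u \<in> mat_kernel M \<Longrightarrow> \<exists>c. \<forall>r<nc. u $ r = (\<Sum>w\<in>W. c w * w $ r)"
    using kernel_basis[OF M] by blast
  have "\<forall>i\<in>I. \<exists>c. \<forall>r<nc. w i $ r = (\<Sum>b\<in>W. c b * b $ r)"
    using W(3) ker by blast
  then obtain a where a: "\<And>i r. i \<in> I \<Longrightarrow> r < nc \<Longrightarrow> w i $ r = (\<Sum>b\<in>W. a i b * b $ r)"
    by metis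
  obtain x where x: "\<forall>b\<in>W. (\<Sum>i\<in>I. a i b * x i) = 0" "\<exists>i\<in>I. x i \<noteq> 0"
    using homogeneous_system_nontrivial[OF W(1) I, of "\<lambda>b i. a i b"] neg W(2) by auto
  have "(\<Sum>i\<in>I. x i * w i $ r) = 0" if "r < nc" for r
  proof -
    have "(\<Sum>i\<in>I. x i * w i $ r) = (\<Sum>i\<in>I. \<Sum>b\<in>W. a i b * x i * b $ r)"
      using a that by (auto intro!: sum.cong simp: sum_distrib_left algebra_simps)
    also have "\<dots> = (\<Sum>b\<in>W. (\<Sum>i\<in>I. a i b * x i) * b $ r)"
      by (subst sum.swap) (simp add: sum_distrib_right)
    finally show ?thesis using x(1) by simp
  qed
  with indep[of x] x(2) show False by auto
qed

section \<open>Positive semidefinite forms and their perturbations\<close>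

text \<open>Vectors are functions on the natural numbers of which only the values below \<open>N\<close> matter, so that
sums and scalings of vectors carry no dimension side conditions.\<close>
definition bil :: "nat \<Rightarrow> (nat \<Rightarrow> nat \<Rightarrow> real) \<Rightarrow> (nat \<Rightarrow> real) \<Rightarrow> (nat \<Rightarrow> real) \<Rightarrow> real" where
  "bil N M v w = (\<Sum>i<N. \<Sum>j<N. M i j * v i * w j)"

lemma bil_add_left: "bil N M (\<lambda>r. v r + u r) w = bil N M v w + bil N M u w"
  by (simp add: bil_def algebra_simps sum.distrib)

lemma bil_scale_left: "bil N M (\<lambda>r. c * v r) w = c * bil N M v w"
  by (simp add: bil_def algebra_simps sum_distrib_left)

lemma bil_sum_left: "bil N M (\<lambda>r. \<Sum>k\<in>K. c k * f k r) w = (\<Sum>k\<in>K. c k * bil N M (f k) w)"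
proof (induction K rule: infinite_finite_induct)
  case (insert k K)
  then show ?case by (simp add: bil_add_left bil_scale_left)
qed (auto simp: bil_def)

lemma bil_commute:
  assumes "\<forall>i<N. \<forall>j<N. M i j = M j i"
  shows "bil N M v w = bil N M w v"
  unfolding bil_def by (subst sum.swap) (auto intro!: sum.cong simp: assms)

text \<open>Otherwise the value of the form at \<open>s v + w\<close> is a nonconstant affine function of \<open>s\<close>, which takes
negative values.\<close>
lemma bil_null_vector:
  assumes sym: "\<forall>i<N. \<forall>j<N. M i j = M j i"
    and psd: "\<And>v. bil N M v v \<ge> 0" and null: "bil N M v v = 0"
  shows "bil N M v w = 0"
proof (rule ccontr)
  assume ne: "bil N M v w \<noteq> 0"
  \<comment> \<open>The value at which the affine function equals -1.\<close>
  define s where "s = - (bil N M w w + 1) / (2 * bil N M v w)"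
  have "bil N M (\<lambda>r. s * v r + w r) (\<lambda>r. s * v r + w r) = bil N M w w + 2 * s * bil N M v w"
    by (simp add: bil_add_left bil_scale_left bil_commute[OF sym, where w = "\<lambda>r. s * v r + w r"]
        null bil_commute[OF sym, where v = w and w = v])
  also have "\<dots> = -1" using ne by (simp add: s_def field_simps)
  finally show False using psd[of "\<lambda>r. s * v r + w r"] by simp
qed

text \<open>Gram--Schmidt for a form that may be degenerate. A basis vector \<open>f i\<close> that is null for the form is
orthogonal to everything by \<open>bil_null_vector\<close>; its coefficient \<open>a i\<close> is a quotient by zero, and the
default value 0 is the right one.\<close>
lemma orthogonal_basis_of_psd_form:
  assumes sym: "\<forall>i<N. \<forall>j<N. M i j = M j i"
    and psd: "\<And>v. bil N M v v \<ge> 0"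
  shows "\<exists>f. (\<forall>i<k. \<forall>j<k. i \<noteq> j \<longrightarrow> bil N M (f i) (f j) = 0) \<and>
    (\<forall>v. (\<forall>r\<ge>k. v r = 0) \<longrightarrow> (\<exists>c. v = (\<lambda>r. \<Sum>i<k. c i * f i r)))"
proof (induction k)
  case 0
  then show ?case by auto
next
  case (Suc k)
  then obtain f where orth: "\<And>i j. i < k \<Longrightarrow> j < k \<Longrightarrow> i \<noteq> j \<Longrightarrow> bil N M (f i) (f j) = 0"
    and span: "\<And>v. \<forall>r\<ge>k. v r = 0 \<Longrightarrow> \<exists>c. v = (\<lambda>r. \<Sum>i<k. c i * f i r)" by metis
  define e where "e = (\<lambda>r. if r = k then 1 else 0 :: real)"
  define a where "a = (\<lambda>i. bil N M e (f i) / bil N M (f i) (f i))"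
  define h where "h = (\<lambda>r. e r + (\<Sum>i<k. - a i * f i r))"
  have orth_h: "bil N M h (f j) = 0" if "j < k" for j
  proof -
    have "bil N M h (f j) = bil N M e (f j) + (\<Sum>i<k. - a i * bil N M (f i) (f j))"
      unfolding h_def by (simp only: bil_add_left bil_sum_left)
    also have "(\<Sum>i<k. - a i * bil N M (f i) (f j)) = (\<Sum>i<k. if i = j then - a j * bil N M (f j) (f j) else 0)"
      using orth that by (intro sum.cong) auto
    also have "\<dots> = - a j * bil N M (f j) (f j)" using that by simp
    also have "\<dots> = - bil N M e (f j)"
    proof (cases "bil N M (f j) (f j) = 0")
      case True
      then have "bil N M (f j) e = 0" by (rule bil_null_vector[OF sym psd])
      then show ?thesis using True bil_commute[OF sym] by simp
    qed (simp add: a_def)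
    finally show ?thesis by simp
  qed
  define F where "F = f(k := h)"
  have "bil N M (F i) (F j) = 0" if "i < Suc k" "j < Suc k" "i \<noteq> j" for i j
  proof -
    consider "i < k" "j < k" | "i = k" "j < k" | "j = k" "i < k" using \<open>i < Suc k\<close> \<open>j < Suc k\<close> \<open>i \<noteq> j\<close> by linarith
    then show ?thesis
      using orth orth_h that bil_commute[OF sym, where v = "f i" and w = h] by cases (auto simp: F_def)
  qed
  moreover have "\<exists>c. v = (\<lambda>r. \<Sum>i<Suc k. c i * F i r)" if v: "\<forall>r\<ge>Suc k. v r = 0" for v
  proof -
    have "\<forall>r\<ge>k. v r - v k * e r = 0" using v by (auto simp: e_def le_Suc_eq not_less_eq_eq)
    from span[OF this] obtain c where c: "(\<lambda>r. v r - v k * e r) = (\<lambda>r. \<Sum>i<k. c i * f i r)" by blast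
    define c' where "c' = (\<lambda>i. if i = k then v k else c i + v k * a i)"
    have "v r = (\<Sum>i<Suc k. c' i * F i r)" for r
    proof -
      have "(\<Sum>i<Suc k. c' i * F i r) = (\<Sum>i<k. (c i + v k * a i) * f i r) + v k * h r"
        by (simp add: c'_def F_def)
      also have "\<dots> = (\<Sum>i<k. c i * f i r) + v k * e r"
        by (simp add: h_def algebra_simps sum.distrib sum_distrib_left sum_negf)
      also have "(\<Sum>i<k. c i * f i r) = v r - v k * e r" using fun_cong[OF c, of r] by simp
      finally show ?thesis by simp
    qed
    then show ?thesis by blast
  qed
  ultimately show ?case by blast
qed

text \<open>In a basis \<open>f\<close> that is orthogonal for \<open>M\<close>, the form \<open>M\<close> is a sum of squares with weights \<open>D i\<close>. Null
vectors of \<open>M\<close> are in the radical of \<open>H\<close>, so only products \<open>c i * c j\<close> with both weights positive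
contribute to \<open>H\<close>, and these are bounded by the sum of squares.\<close>
lemma form_dominated_by_psd_form:
  assumes symM: "\<forall>i<N. \<forall>j<N. M i j = M j i"
    and psd: "\<And>v. bil N M v v \<ge> 0"
    and symH: "\<forall>i<N. \<forall>j<N. H i j = H j i"
    and null: "\<And>v w. bil N M v v = 0 \<Longrightarrow> bil N H v w = 0"
  shows "\<exists>K\<ge>0. \<forall>v. \<bar>bil N H v v\<bar> \<le> K * bil N M v v"
proof -
  obtain f where orth: "\<And>i j. i < N \<Longrightarrow> j < N \<Longrightarrow> i \<noteq> j \<Longrightarrow> bil N M (f i) (f j) = 0"
    and span: "\<And>v. \<forall>r\<ge>N. v r = 0 \<Longrightarrow> \<exists>c. v = (\<lambda>r. \<Sum>i<N. c i * f i r)"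
    using orthogonal_basis_of_psd_form[OF symM psd, of N] by metis
  define D where "D = (\<lambda>i. bil N M (f i) (f i))"
  define K where "K = (\<Sum>i<N. \<Sum>j<N. \<bar>bil N H (f i) (f j)\<bar> * (1 / D i + 1 / D j))"
  have D0: "D i \<ge> 0" for i using psd by (simp add: D_def)
  have "K \<ge> 0" unfolding K_def using D0 by (intro sum_nonneg) auto
  moreover have "\<bar>bil N H v v\<bar> \<le> K * bil N M v v" for v
  proof -
    define v' where "v' = (\<lambda>r. if r < N then v r else 0)"
    have cut: "bil N Q v v = bil N Q v' v'" for Q by (auto simp: bil_def v'_def)
    obtain c where c: "v' = (\<lambda>r. \<Sum>i<N. c i * f i r)" using span[of v'] by (auto simp: v'_def)
    have expand: "bil N Q v' v' = (\<Sum>i<N. \<Sum>j<N. c i * c j * bil N Q (f i) (f j))"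
      if "\<forall>i<N. \<forall>j<N. Q i j = Q j i" for Q
    proof -
      have "bil N Q v' v' = (\<Sum>i<N. c i * bil N Q (f i) v')"
        by (subst (1) c) (rule bil_sum_left)
      also have "\<dots> = (\<Sum>i<N. c i * (\<Sum>j<N. c j * bil N Q (f j) (f i)))"
        by (subst bil_commute[OF that], subst c, subst bil_sum_left, rule refl)
      also have "\<dots> = (\<Sum>i<N. \<Sum>j<N. c i * c j * bil N Q (f i) (f j))"
        using bil_commute[OF that] by (auto simp: sum_distrib_left algebra_simps intro!: sum.cong)
      finally show ?thesis .
    qed
    define S where "S = bil N M v' v'"
    have S: "S = (\<Sum>i<N. (c i)\<^sup>2 * D i)"
    proof -
      have "S = (\<Sum>i<N. \<Sum>j<N. if j = i then (c i)\<^sup>2 * D i else 0)"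
        unfolding S_def expand[OF symM] using orth 
        by (intro sum.cong refl) (auto simp: D_def power2_eq_square)
      then show ?thesis by simp
    qed
    have S0: "S \<ge> 0" using psd S_def by simp
    have ci: "(c i)\<^sup>2 \<le> S * (1 / D i)" if "i < N" "D i \<noteq> 0" for i
    proof -
      have "(c i)\<^sup>2 * D i \<le> S" unfolding S using that D0 by (intro member_le_sum) auto
      then show ?thesis using that D0[of i] by (simp add: field_simps)
    qed
    have term_le: "\<bar>c i * c j * bil N H (f i) (f j)\<bar> \<le> \<bar>bil N H (f i) (f j)\<bar> * (1 / D i + 1 / D j) * S"
      if ij: "i < N" "j < N" for i j
    proof (cases "D i = 0 \<or> D j = 0")
      case True
      then have "bil N H (f i) (f j) = 0"
        using null[of "f i" "f j"] null[of "f j" "f i"] bil_commute[OF symH] by (auto simp: D_def)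
      then show ?thesis by simp
    next
      case False
      have "\<bar>c i\<bar> * \<bar>c j\<bar> \<le> (c i)\<^sup>2 + (c j)\<^sup>2"
        using sum_squares_bound[of "\<bar>c i\<bar>" "\<bar>c j\<bar>"] zero_le_power2[of "c i"] zero_le_power2[of "c j"]
        by (simp only: power2_abs)
      also have "\<dots> \<le> S * (1 / D i) + S * (1 / D j)" using ci ij False by (intro add_mono) auto
      finally have "\<bar>c i\<bar> * \<bar>c j\<bar> \<le> (1 / D i + 1 / D j) * S" by (simp add: algebra_simps)
      then have "\<bar>bil N H (f i) (f j)\<bar> * (\<bar>c i\<bar> * \<bar>c j\<bar>) \<le> \<bar>bil N H (f i) (f j)\<bar> * ((1 / D i + 1 / D j) * S)"
        by (intro mult_left_mono) auto
      then show ?thesis by (simp add: abs_mult mult_ac)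
    qed
    have "\<bar>bil N H v' v'\<bar> \<le> (\<Sum>i<N. \<Sum>j<N. \<bar>c i * c j * bil N H (f i) (f j)\<bar>)"
      unfolding expand[OF symH] by (intro order_trans[OF sum_abs] sum_mono sum_abs)
    also have "\<dots> \<le> (\<Sum>i<N. \<Sum>j<N. \<bar>bil N H (f i) (f j)\<bar> * (1 / D i + 1 / D j) * S)"
      using term_le by (intro sum_mono) auto
    also have "\<dots> = K * S" by (simp add: K_def sum_distrib_right)
    finally show ?thesis using cut by (simp add: S_def)
  qed
  ultimately show ?thesis by blast
qed

lemma quadratic_form_eq_bil:
  assumes "M \<in> carrier_mat N N" "v \<in> carrier_vec N" "w \<in> carrier_vec N"
  shows "v \<bullet> (M *\<^sub>v w) = bil N (\<lambda>i j. M $$ (i, j)) (($) v) (($) w)"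
  using assms by (auto simp: bil_def scalar_prod_def sum_distrib_left lessThan_atLeast0 mult_ac
    intro!: sum.cong)

lemma bil_vec: "bil N M (($) (vec N v)) (($) (vec N w)) = bil N M v w"
  by (auto simp: bil_def)

lemma psd_iff_bil:
  assumes "M \<in> carrier_mat N N" 
  shows "psd M \<longleftrightarrow> (\<forall>i<N. \<forall>j<N. M $$ (i, j) = M $$ (j, i)) \<and> (\<forall>v. bil N (\<lambda>i j. M $$ (i, j)) v v \<ge> 0)"
proof -
  have "M\<^sup>T = M \<longleftrightarrow> (\<forall>i<N. \<forall>j<N. M $$ (i, j) = M $$ (j, i))"
    using assms by (auto simp: mat_eq_iff)
  moreover have "(\<forall>v\<in>carrier_vec N. v \<bullet> (M *\<^sub>v v) \<ge> 0) \<longleftrightarrow> (\<forall>v. bil N (\<lambda>i j. M $$ (i, j)) v v \<ge> 0)"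
    using assms quadratic_form_eq_bil[OF assms] bil_vec[of N "\<lambda>i j. M $$ (i, j)"]
    by (metis vec_carrier)
  ultimately show ?thesis using assms by (auto simp: psd_def)
qed

lemma psd_null_vector:
  assumes M: "M \<in> carrier_mat N N" and psd: "psd M" and v: "v \<in> carrier_vec N"
    and null: "v \<bullet> (M *\<^sub>v v) = 0"
  shows "M *\<^sub>v v = 0\<^sub>v N"
proof (rule eq_vecI)
  fix i assume "i < dim_vec (0\<^sub>v N :: real vec)"
  then have i: "i < N" by simp
  let ?M = "\<lambda>i j. M $$ (i, j)"
  have p: "\<forall>i<N. \<forall>j<N. ?M i j = ?M j i" "\<And>v. bil N ?M v v \<ge> 0"
    using psd psd_iff_bil[OF M] by blast+
  have "0 = bil N ?M (($) v) (($) (unit_vec N i))"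
    using bil_null_vector[OF p] null quadratic_form_eq_bil[OF M v v] by simp
  also have "\<dots> = unit_vec N i \<bullet> (M *\<^sub>v v)"
    using quadratic_form_eq_bil[OF M unit_vec_carrier v] bil_commute[OF p(1)] by simp
  also have "\<dots> = (M *\<^sub>v v) $ i" using i M v by (intro scalar_prod_left_unit) auto
  finally show "(M *\<^sub>v v) $ i = 0\<^sub>v N $ i" using i by simp
qed (use M in auto)

text \<open>This is what makes kernels control extreme points: \<open>M\<close> may be moved a little in both directions along
\<open>H\<close> as soon as \<open>H\<close> vanishes on the kernel of \<open>M\<close>.\<close>
lemma psd_perturbation:
  assumes M: "M \<in> carrier_mat N N" and psd: "psd M"
    and H: "H \<in> carrier_mat N N" and symH: "H\<^sup>T = H"
    and ker: "mat_kernel M \<subseteq> mat_kernel H"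
  shows "\<exists>\<epsilon>>0. \<forall>t. \<bar>t\<bar> \<le> \<epsilon> \<longrightarrow> psd (M + t \<cdot>\<^sub>m H)"
proof -
  let ?M = "\<lambda>i j. M $$ (i, j)" and ?H = "\<lambda>i j. H $$ (i, j)"
  have pM: "\<forall>i<N. \<forall>j<N. ?M i j = ?M j i" "\<And>v. bil N ?M v v \<ge> 0"
    using psd psd_iff_bil[OF M] by blast+
  have pH: "\<forall>i<N. \<forall>j<N. ?H i j = ?H j i" using symH H by (metis carrier_matD(1) carrier_matD(2) index_transpose_mat(1))
  have "bil N ?H v w = 0" if "bil N ?M v v = 0" for v w
  proof -
    have "vec N v \<bullet> (M *\<^sub>v vec N v) = 0"
      using that bil_vec quadratic_form_eq_bil[OF M, of "vec N v" "vec N v"] by simp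
    then have "M *\<^sub>v vec N v = 0\<^sub>v N" by (intro psd_null_vector[OF M psd]) auto
    then have "vec N v \<in> mat_kernel M" using M by (intro mat_kernelI) auto
    with ker have "H *\<^sub>v vec N v = 0\<^sub>v N" using H mat_kernelD by blast
    then have "vec N w \<bullet> (H *\<^sub>v vec N v) = 0" by simp
    then show ?thesis using bil_vec quadratic_form_eq_bil[OF H, of "vec N w" "vec N v"]
        bil_commute[OF pH] by simp
  qed
  from form_dominated_by_psd_form[OF pM pH this] obtain K where K: "K \<ge> 0"
    "\<And>v. \<bar>bil N ?H v v\<bar> \<le> K * bil N ?M v v" by blast
  have "psd (M + t \<cdot>\<^sub>m H)" if t: "\<bar>t\<bar> \<le> 1 / (K + 1)" for t
  proof -
    have MH: "M + t \<cdot>\<^sub>m H \<in> carrier_mat N N" using M H by auto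
    have "bil N (\<lambda>i j. (M + t \<cdot>\<^sub>m H) $$ (i, j)) v v = bil N ?M v v + t * bil N ?H v v" for v
      using M H by (auto simp: bil_def algebra_simps sum.distrib sum_distrib_left)
    moreover have "bil N ?M v v + t * bil N ?H v v \<ge> 0" for v
    proof -
      have "\<bar>t * bil N ?H v v\<bar> \<le> 1 / (K + 1) * (K * bil N ?M v v)"
        unfolding abs_mult using t K(2)[of v] by (intro mult_mono) (use K in auto)
      also have "\<dots> \<le> bil N ?M v v" using K pM(2)[of v] by (simp add: field_simps)
      finally show ?thesis by linarith
    qed
    moreover have "(M + t \<cdot>\<^sub>m H) $$ (i, j) = (M + t \<cdot>\<^sub>m H) $$ (j, i)" if "i < N" "j < N" for i j
      using that M H pM(1) pH by simp
    ultimately show ?thesis unfolding psd_iff_bil[OF MH] by auto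
  qed
  then show ?thesis using K by (intro exI[of _ "1 / (K + 1)"]) auto
qed

section \<open>Pencils and the equation count at extreme points\<close>

lemma SM_D:
  assumes "X \<in> SM g n"
  shows "length X = g" "i < g \<Longrightarrow> X ! i \<in> carrier_mat n n" "i < g \<Longrightarrow> (X ! i)\<^sup>T = X ! i"
    "i < g \<Longrightarrow> p < n \<Longrightarrow> q < n \<Longrightarrow> X ! i $$ (p, q) = X ! i $$ (q, p)"
    "i < g \<Longrightarrow> dim_row (X ! i) = n" "i < g \<Longrightarrow> dim_col (X ! i) = n"
proof -
  show "length X = g" "i < g \<Longrightarrow> X ! i \<in> carrier_mat n n" "i < g \<Longrightarrow> (X ! i)\<^sup>T = X ! i"
    "i < g \<Longrightarrow> dim_row (X ! i) = n" "i < g \<Longrightarrow> dim_col (X ! i) = n"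
    using assms by (auto simp: SM_def)
  assume "i < g" "p < n" "q < n"
  then have "X ! i \<in> carrier_mat n n" "(X ! i)\<^sup>T = X ! i" using assms by (auto simp: SM_def)
  then show "X ! i $$ (p, q) = X ! i $$ (q, p)"
    by (metis \<open>p < n\<close> \<open>q < n\<close> carrier_matD(1) carrier_matD(2) index_transpose_mat(1))
qed

lemma SM_I:
  assumes "length X = g" "\<And>i. i < g \<Longrightarrow> X ! i \<in> carrier_mat n n"
    "\<And>i p q. i < g \<Longrightarrow> p < n \<Longrightarrow> q < n \<Longrightarrow> X ! i $$ (p, q) = X ! i $$ (q, p)"
  shows "X \<in> SM g n"
proof -
  have "(X ! i)\<^sup>T = X ! i" if "i < g" for i
    using assms(2)[OF that] assms(3)[OF that] by (intro eq_matI) auto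
  then show ?thesis using assms by (auto simp: SM_def in_set_conv_nth)
qed

text \<open>The tuple \<open>X\<close> enters the pencil through this sum of Kronecker products, which is linear in \<open>X\<close>. Its entry
at \<open>(r, s)\<close> belongs to the pairs \<open>(r div n, r mod n)\<close> and \<open>(s div n, s mod n)\<close>.\<close>
definition lin_pencil :: "nat \<Rightarrow> nat \<Rightarrow> tuple \<Rightarrow> tuple \<Rightarrow> real mat" where
  "lin_pencil d n A X = mat (d * n) (d * n)
     (\<lambda>(r, s). \<Sum>i<length A. A ! i $$ (r div n, s div n) * X ! i $$ (r mod n, s mod n))"

lemma div_mod_less: "r < d * n \<Longrightarrow> r div n < d \<and> r mod n < (n::nat)"
  by (metis less_mult_imp_div_less mod_less_divisor gr0I mult_0_right not_less0)

lemma foldl_minus_kron: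
  assumes "length A = length X" "\<forall>M\<in>set A. M \<in> carrier_mat d d" "\<forall>M\<in>set X. M \<in> carrier_mat n n"
    "M0 \<in> carrier_mat (d * n) (d * n)"
  shows "foldl (\<lambda>M (a, x). M - kron a x) M0 (zip A X) = M0 - lin_pencil d n A X"
  using assms
proof (induction A X arbitrary: M0 rule: list_induct2)
  case Nil
  then show ?case by (intro eq_matI) (auto simp: lin_pencil_def)
next
  case (Cons a A x X)
  have "kron a x \<in> carrier_mat (d * n) (d * n)" using Cons.prems by (auto simp: kron_def)
  then have "M0 - kron a x \<in> carrier_mat (d * n) (d * n)" by (simp add: minus_carrier_mat)
  then have IH: "foldl (\<lambda>M (a, x). M - kron a x) (M0 - kron a x) (zip A X) = M0 - kron a x - lin_pencil d n A X"
    using Cons by simp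
  show ?case unfolding zip_Cons_Cons foldl_Cons prod.case IH
    using Cons.prems div_mod_less
    by (intro eq_matI) (auto simp: lin_pencil_def kron_def sum.lessThan_Suc_shift simp del: sum.lessThan_Suc)
qed

lemma pencil_eq:
  assumes "A \<in> SM g d" "X \<in> SM g n"
  shows "pencil d n A X = 1\<^sub>m (d * n) - lin_pencil d n A X"
  unfolding pencil_def using assms by (intro foldl_minus_kron) (auto simp: SM_def)

lemma lin_pencil_carrier[simp]: "lin_pencil d n A X \<in> carrier_mat (d * n) (d * n)"
  by (simp add: lin_pencil_def)

lemma pencil_carrier:
  assumes "A \<in> SM g d" "X \<in> SM g n"
  shows "pencil d n A X \<in> carrier_mat (d * n) (d * n)"
  unfolding pencil_eq[OF assms] by (intro minus_carrier_mat) simp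

lemma lin_pencil_sym:
  assumes "A \<in> SM g d" "X \<in> SM g n"
  shows "(lin_pencil d n A X)\<^sup>T = lin_pencil d n A X"
  using SM_D[OF assms(1)] SM_D[OF assms(2)]
  by (intro eq_matI) (auto simp: lin_pencil_def dest!: div_mod_less intro!: sum.cong)

lemma pencil_index:
  assumes "A \<in> SM g d" "X \<in> SM g n" "r < d * n" "s < d * n"
  shows "pencil d n A X $$ (r, s) = (if r = s then 1 else 0) -
     (\<Sum>i<g. A ! i $$ (r div n, s div n) * X ! i $$ (r mod n, s mod n))"
  using assms(3,4) SM_D(1)[OF assms(1)] by (simp add: pencil_eq[OF assms(1,2)] lin_pencil_def)

definition shift_tuple :: "tuple \<Rightarrow> real \<Rightarrow> tuple \<Rightarrow> tuple" where
  "shift_tuple X t B = map2 (\<lambda>x b. x + t \<cdot>\<^sub>m b) X B"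

lemma shift_tuple_SM:
  assumes "X \<in> SM g n" "B \<in> SM g n"
  shows "shift_tuple X t B \<in> SM g n"
  using SM_D[OF assms(1)] SM_D[OF assms(2)] by (intro SM_I) (auto simp: shift_tuple_def)

lemma pencil_shift:
  assumes "A \<in> SM g d" "X \<in> SM g n" "B \<in> SM g n"
  shows "pencil d n A (shift_tuple X t B) = pencil d n A X + (- t) \<cdot>\<^sub>m lin_pencil d n A B"
  using SM_D[OF assms(1)] SM_D[OF assms(2)] SM_D[OF assms(3)]
  unfolding pencil_eq[OF assms(1,2)] pencil_eq[OF assms(1) shift_tuple_SM[OF assms(2,3)]]
  by (intro eq_matI) (auto simp: lin_pencil_def shift_tuple_def dest!: div_mod_less 
     simp: algebra_simps sum.distrib sum_distrib_left sum_negf)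

text \<open>\<open>X\<close> is the midpoint of \<open>X + t B\<close> and \<open>X - t B\<close>, which must coincide.\<close>
lemma euclidean_extreme_no_segment:
  assumes ext: "euclidean_extreme g d A n X" and B: "B \<in> SM g n" and "t > 0"
    and psd: "\<And>s. \<bar>s\<bar> \<le> t \<Longrightarrow> psd (pencil d n A (shift_tuple X s B))"
    and i: "i < g" "p < n" "q < n"
  shows "B ! i $$ (p, q) = 0"
proof (rule ccontr)
  assume nz: "B ! i $$ (p, q) \<noteq> 0"
  let ?Y = "shift_tuple X t B" and ?Z = "shift_tuple X (- t) B"
  have X: "X \<in> SM g n" using ext by (simp add: euclidean_extreme_def free_spec_level_def)
  have D: "?Y \<in> free_spec_level g d A n" "?Z \<in> free_spec_level g d A n"
    using psd \<open>t > 0\<close> shift_tuple_SM[OF X B] by (auto simp: free_spec_level_def)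
  have "?Y ! i $$ (p, q) - ?Z ! i $$ (p, q) = 2 * t * B ! i $$ (p, q)"
    using SM_D[OF X] SM_D[OF B] i by (simp add: shift_tuple_def)
  then have "?Y \<noteq> ?Z" using nz \<open>t > 0\<close> by auto
  moreover have "X = convex_comb (1 / 2) ?Y ?Z"
  proof (rule nth_equalityI)
    fix k assume "k < length X"
    then have k: "k < g" using SM_D[OF X] by simp
    have [simp]: "length X = g" "length B = g" using SM_D[OF X] SM_D[OF B] by auto
    show "X ! k = convex_comb (1 / 2) ?Y ?Z ! k"
      using SM_D[OF X] SM_D[OF B] k 
      by (intro eq_matI) (auto simp: convex_comb_def shift_tuple_def field_simps)
  qed (use SM_D[OF X] SM_D[OF B] in \<open>simp add: convex_comb_def shift_tuple_def\<close>)
  moreover have "0 < (1 / 2 :: real)" "(1 / 2 :: real) < 1" by simp_all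
  ultimately show False using ext D unfolding euclidean_extreme_def by blast
qed

text \<open>The central count. Suppose that at level \<open>n\<close> the free spectrahedron of \<open>A\<close> contains the intersection
of those of finitely many tuples \<open>C j\<close>. A symmetric tuple \<open>B\<close> whose linear pencils vanish on the kernels
of all \<open>C j\<close> at \<open>X\<close> is a direction in which \<open>X\<close> can be moved both ways, so \<open>B\<close> is zero if \<open>X\<close> is extreme.
Testing on bases of the kernels, the vanishing amounts to \<open>e j * n\<close> equations per basis vector, and
\<open>B\<close> has \<open>g n (n + 1) / 2\<close> free entries; there must be at least as many equations as unknowns.\<close>
lemma extreme_point_equation_count:
  fixes C :: "'j \<Rightarrow> tuple"
  assumes n: "n \<ge> 1" and ext: "euclidean_extreme g d A n X" and J: "finite J"
    and C: "\<And>j. j \<in> J \<Longrightarrow> C j \<in> SM g (e j)"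
    and XC: "\<And>j. j \<in> J \<Longrightarrow> psd (pencil (e j) n (C j) X)"
    and cover: "\<And>Y. Y \<in> SM g n \<Longrightarrow> \<forall>j\<in>J. psd (pencil (e j) n (C j) Y) \<Longrightarrow> psd (pencil d n A Y)"
  shows "real g * (real n + 1) / 2 \<le> (\<Sum>j\<in>J. real (e j) * real (kernel_dim (pencil (e j) n (C j) X)))"
proof (rule ccontr)
  assume neg: "\<not> ?thesis"
  have X: "X \<in> SM g n" using ext by (simp add: euclidean_extreme_def free_spec_level_def)
  let ?L = "\<lambda>j. pencil (e j) n (C j) X"
  have "\<forall>j\<in>J. \<exists>W. finite W \<and> card W = kernel_dim (?L j) \<and> W \<subseteq> mat_kernel (?L j) \<and>
      (\<forall>u\<in>mat_kernel (?L j). \<exists>c. \<forall>r<e j * n. u $ r = (\<Sum>w\<in>W. c w * w $ r))"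
  proof
    fix j assume "j \<in> J"
    show "\<exists>W. finite W \<and> card W = kernel_dim (?L j) \<and> W \<subseteq> mat_kernel (?L j) \<and>
      (\<forall>u\<in>mat_kernel (?L j). \<exists>c. \<forall>r<e j * n. u $ r = (\<Sum>w\<in>W. c w * w $ r))"
      using kernel_basis[OF pencil_carrier[OF C[OF \<open>j \<in> J\<close>] X]] by blast
  qed
  from bchoice[OF this] obtain W where W0: "\<forall>j\<in>J. finite (W j) \<and> card (W j) = kernel_dim (?L j) \<and> W j \<subseteq> mat_kernel (?L j) \<and>
      (\<forall>u\<in>mat_kernel (?L j). \<exists>c. \<forall>r<e j * n. u $ r = (\<Sum>w\<in>W j. c w * w $ r))" ..
  have W: "\<And>j. j \<in> J \<Longrightarrow> finite (W j)" "\<And>j. j \<in> J \<Longrightarrow> card (W j) = kernel_dim (?L j)"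
    "\<And>j. j \<in> J \<Longrightarrow> W j \<subseteq> mat_kernel (?L j)"
    "\<And>j u. j \<in> J \<Longrightarrow> u \<in> mat_kernel (?L j) \<Longrightarrow> \<exists>c. \<forall>r<e j * n. u $ r = (\<Sum>w\<in>W j. c w * w $ r)"
    using W0 by simp_all
  \<comment> \<open>One equation for each index \<open>j\<close>, kernel basis vector \<open>w\<close> and row \<open>r\<close>; one unknown for each tuple entry and each position on or below the diagonal.\<close>
  define E where "E = Sigma J (\<lambda>j. W j \<times> {..<e j * n})"
  define V where "V = {..<g} \<times> Sigma {..<n} (\<lambda>q. {..q})"
  define \<phi> where "\<phi> = (\<lambda>(j :: 'j, w :: real vec, r :: nat) (i :: nat, s :: nat). (i, max (r mod n) (s mod n), min (r mod n) (s mod n)))"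
  define a where "a = (\<lambda>(j, w, r) (i, s). C j ! i $$ (r div n, s div n) * w $ s)"
  define K where "K = (\<lambda>(j, w :: real vec, r :: nat). {..<g} \<times> {..<e j * n})"
  have "card E = (\<Sum>j\<in>J. e j * n * kernel_dim (?L j))"
    using J W by (simp add: E_def card_SigmaI card_cartesian_product mult_ac)
  then have "real (card E) = real n * (\<Sum>j\<in>J. real (e j) * real (kernel_dim (?L j)))"
    by (simp add: sum_distrib_left mult_ac)
  also have "\<dots> < real n * (real g * (real n + 1) / 2)" using neg n by simp
  also have "\<dots> = real (card V)"
  proof -
    have "2 * (\<Sum>q<m. Suc q) = m * (m + 1)" for m by (induction m) auto
    from this[of n] have "2 * real (\<Sum>q<n. Suc q) = real n * (real n + 1)"
      by (metis of_nat_1 of_nat_add of_nat_mult of_nat_numeral)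
    then have s: "real (\<Sum>q<n. Suc q) = real n * (real n + 1) / 2" by simp
    have "card V = g * (\<Sum>q<n. Suc q)" by (simp add: V_def card_cartesian_product)
    then show ?thesis by (simp only: of_nat_mult s) (simp add: algebra_simps)
  qed
  finally have card: "card E < card V" by simp
  have fin: "finite E" "finite V" using J W by (auto simp: E_def V_def)
  have "\<phi> x ` K x \<subseteq> V" if "x \<in> E" for x
    using that n by (auto simp: \<phi>_def K_def V_def E_def)
  then obtain x where x: "\<forall>k\<in>E. (\<Sum>m\<in>K k. a k m * x (\<phi> k m)) = 0" "\<exists>v\<in>V. x v \<noteq> 0"
    using homogeneous_system_nontrivial_reindexed[OF fin card, of K \<phi> a] by (auto simp: K_def)
  define B where "B = map (\<lambda>i. mat n n (\<lambda>(p, q). x (i, max p q, min p q))) [0..<g]"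
  have B: "B \<in> SM g n" by (intro SM_I) (auto simp: B_def max.commute min.commute)
  let ?H = "\<lambda>j. lin_pencil (e j) n (C j) B"
  have H_W: "(\<Sum>s<e j * n. ?H j $$ (r, s) * w $ s) = 0" if "j \<in> J" "w \<in> W j" "r < e j * n" for j w r
  proof -
    have "(\<Sum>s<e j * n. ?H j $$ (r, s) * w $ s)
      = (\<Sum>s<e j * n. \<Sum>i<g. a (j, w, r) (i, s) * x (\<phi> (j, w, r) (i, s)))"
      using that SM_D(1)[OF C[OF that(1)]] div_mod_less[of _ "e j" n]
      by (auto simp: lin_pencil_def a_def \<phi>_def B_def sum_distrib_left sum_distrib_right mult_ac intro!: sum.cong)
    also have "\<dots> = (\<Sum>m\<in>K (j, w, r). a (j, w, r) m * x (\<phi> (j, w, r) m))"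
      by (subst sum.swap) (simp add: K_def sum.cartesian_product)
    also have "\<dots> = 0" using x(1) that by (auto simp: E_def)
    finally show ?thesis .
  qed
  have ker: "mat_kernel (?L j) \<subseteq> mat_kernel (?H j)" if j: "j \<in> J" for j
  proof
    fix u assume u: "u \<in> mat_kernel (?L j)"
    have uc: "u \<in> carrier_vec (e j * n)" using mat_kernelD(1)[OF pencil_carrier[OF C X] u] j by blast
    obtain c where c: "\<And>r. r < e j * n \<Longrightarrow> u $ r = (\<Sum>w\<in>W j. c w * w $ r)" using W(4)[OF j u] by auto
    show "u \<in> mat_kernel (?H j)"
    proof (rule mat_kernelI[OF _ uc])
      show "?H j *\<^sub>v u = 0\<^sub>v (e j * n)"
      proof (rule eq_vecI)
        fix r assume "r < dim_vec (0\<^sub>v (e j * n) :: real vec)"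
        then have r: "r < e j * n" by simp
        have "(?H j *\<^sub>v u) $ r = (\<Sum>s<e j * n. ?H j $$ (r, s) * u $ s)"
          using r uc carrier_matD[OF lin_pencil_carrier[of "e j" n "C j" B]] by (simp add: scalar_prod_def lessThan_atLeast0)
        also have "\<dots> = (\<Sum>s<e j * n. \<Sum>w\<in>W j. c w * (?H j $$ (r, s) * w $ s))"
          using c by (simp add: sum_distrib_left sum_distrib_right mult_ac)
        also have "\<dots> = (\<Sum>w\<in>W j. c w * (\<Sum>s<e j * n. ?H j $$ (r, s) * w $ s))"
          by (subst sum.swap) (simp add: sum_distrib_left sum_distrib_right)
        also have "\<dots> = 0" using H_W j r by simp
        finally show "(?H j *\<^sub>v u) $ r = 0\<^sub>v (e j * n) $ r" using r by simp
      qed (simp add: lin_pencil_def)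
    qed simp
  qed
  have "\<forall>j\<in>J. \<exists>\<epsilon>>0. \<forall>t. \<bar>t\<bar> \<le> \<epsilon> \<longrightarrow> psd (?L j + t \<cdot>\<^sub>m ?H j)"
    by (intro ballI psd_perturbation[OF pencil_carrier[OF C X] XC lin_pencil_carrier lin_pencil_sym[OF C B] ker])
  from bchoice[OF this] obtain \<epsilon> where \<epsilon>0: "\<forall>j\<in>J. 0 < \<epsilon> j \<and> (\<forall>t. \<bar>t\<bar> \<le> \<epsilon> j \<longrightarrow> psd (?L j + t \<cdot>\<^sub>m ?H j))" ..
  have \<epsilon>: "\<And>j. j \<in> J \<Longrightarrow> \<epsilon> j > 0"
    "\<And>j t. j \<in> J \<Longrightarrow> \<bar>t\<bar> \<le> \<epsilon> j \<Longrightarrow> psd (?L j + t \<cdot>\<^sub>m ?H j)"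
    using \<epsilon>0 by simp_all
  define t where "t = Min (insert 1 (\<epsilon> ` J))"
  have t: "t > 0" "\<And>j. j \<in> J \<Longrightarrow> t \<le> \<epsilon> j" using J \<epsilon>(1) by (auto simp: t_def)
  have "psd (pencil d n A (shift_tuple X s B))" if "\<bar>s\<bar> \<le> t" for s
  proof (rule cover[OF shift_tuple_SM[OF X B]], intro ballI)
    fix j assume "j \<in> J"
    with that t(2) have "\<bar>- s\<bar> \<le> \<epsilon> j" by fastforce
    with \<epsilon>(2) \<open>j \<in> J\<close> show "psd (pencil (e j) n (C j) (shift_tuple X s B))"
      using pencil_shift[OF C X B] by simp
  qed
  then have zero: "B ! i $$ (p, q) = 0" if "i < g" "p < n" "q < n" for i p q
    using euclidean_extreme_no_segment[OF ext B t(1)] that by blast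
  obtain i p q where v: "i < g" "q < n" "p \<le> q" "x (i, q, p) \<noteq> 0" using x(2) by (auto simp: V_def)
  have "B ! i $$ (p, q) = x (i, q, p)" using v by (simp add: B_def max_def min_def)
  with zero[of i p q] v show False by simp
qed

section \<open>Unitary equivalence and direct sums\<close>

lemma sum_div_mod:
  fixes f :: "nat \<Rightarrow> nat \<Rightarrow> real"
  shows "(\<Sum>r<d * n. f (r div n) (r mod n)) = (\<Sum>p<d. \<Sum>q<n. f p q)"
proof -
  have "(\<Sum>r<d * n. f (r div n) (r mod n)) = (\<Sum>(p, q)\<in>{..<d} \<times> {..<n}. f p q)"
  proof (rule sum.reindex_bij_witness[of _ "\<lambda>(p, q). p * n + q" "\<lambda>r. (r div n, r mod n)"])
    fix x assume "x \<in> {..<d} \<times> {..<n}"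
    then obtain p q where x: "x = (p, q)" "p < d" "q < n" by auto
    have "p * n + q < Suc p * n" using x by simp
    also have "\<dots> \<le> d * n" using x by (intro mult_right_mono) auto
    finally show "(case x of (p, q) \<Rightarrow> p * n + q) \<in> {..<d * n}" using x by simp
  qed (auto dest: div_mod_less)
  then show ?thesis by (simp add: sum.cartesian_product)
qed

text \<open>The quadratic form of the pencil on the tensor product of \<open>\<real>\<^sup>d\<close> and \<open>\<real>\<^sup>n\<close>, with a tensor stored as its
\<open>n\<close> slices in \<open>\<real>\<^sup>d\<close>. Maps that act on the first factor only, such as a change of basis for \<open>A\<close> or a
splitting into blocks, act on each slice separately.\<close>
definition pencil_form :: "nat \<Rightarrow> tuple \<Rightarrow> tuple \<Rightarrow> (nat \<Rightarrow> real vec) \<Rightarrow> real" where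
  "pencil_form n A X v = (\<Sum>q<n. v q \<bullet> v q) -
     (\<Sum>i<length A. \<Sum>q<n. \<Sum>q'<n. X ! i $$ (q, q') * (v q \<bullet> (A ! i *\<^sub>v v q')))"

text \<open>The index \<open>r\<close> below \<open>d * n\<close> of the Kronecker product stands for the pair \<open>(r div n, r mod n)\<close>.\<close>
lemma bil_pencil:
  assumes A: "A \<in> SM g d" and X: "X \<in> SM g n" and v: "\<And>q. q < n \<Longrightarrow> v q \<in> carrier_vec d"
  shows "bil (d * n) (\<lambda>r s. pencil d n A X $$ (r, s)) (\<lambda>r. v (r mod n) $ (r div n)) (\<lambda>r. v (r mod n) $ (r div n))
    = pencil_form n A X v"
proof -
  define u where "u = (\<lambda>p q. v q $ p)"
  let ?u = "\<lambda>r. v (r mod n) $ (r div n)"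
  have "bil (d * n) (\<lambda>r s. pencil d n A X $$ (r, s)) ?u ?u
    = (\<Sum>r<d*n. \<Sum>s<d*n. (if s = r then ?u r * ?u r else 0) -
      (\<Sum>i<g. A ! i $$ (r div n, s div n) * X ! i $$ (r mod n, s mod n) * ?u r * ?u s))"
    unfolding bil_def using pencil_index[OF A X]
    by (intro sum.cong refl) (auto simp: left_diff_distrib sum_distrib_right)
  also have "\<dots> = (\<Sum>r<d*n. ?u r * ?u r) - 
      (\<Sum>i<g. \<Sum>r<d*n. \<Sum>s<d*n. A ! i $$ (r div n, s div n) * X ! i $$ (r mod n, s mod n) * ?u r * ?u s)"
    by (simp add: sum_subtractf sum.swap[where A = "{..<g}"])
  also have "(\<Sum>r<d*n. ?u r * ?u r) = (\<Sum>p<d. \<Sum>q<n. u p q * u p q)"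
    unfolding u_def by (rule sum_div_mod)
  also have "\<dots> = (\<Sum>q<n. v q \<bullet> v q)"
    using carrier_vecD[OF v] by (subst sum.swap) (simp add: scalar_prod_def u_def lessThan_atLeast0)
  also have "(\<Sum>i<g. \<Sum>r<d*n. \<Sum>s<d*n. A ! i $$ (r div n, s div n) * X ! i $$ (r mod n, s mod n) * ?u r * ?u s)
    = (\<Sum>i<g. \<Sum>q<n. \<Sum>q'<n. X ! i $$ (q, q') * (v q \<bullet> (A ! i *\<^sub>v v q')))"
  proof (rule sum.cong[OF refl])
    fix i assume i: "i \<in> {..<g}"
    have "(\<Sum>r<d*n. \<Sum>s<d*n. A ! i $$ (r div n, s div n) * X ! i $$ (r mod n, s mod n) * ?u r * ?u s)
      = (\<Sum>r<d*n. \<Sum>p'<d. \<Sum>q'<n. A ! i $$ (r div n, p') * X ! i $$ (r mod n, q') * ?u r * u p' q')"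
      by (subst sum_div_mod[symmetric]) (simp add: u_def)
    also have "\<dots> = (\<Sum>p<d. \<Sum>q<n. \<Sum>p'<d. \<Sum>q'<n. A ! i $$ (p, p') * X ! i $$ (q, q') * u p q * u p' q')"
      by (subst sum_div_mod[symmetric]) (simp add: u_def)
    also have "\<dots> = (\<Sum>q<n. \<Sum>p<d. \<Sum>p'<d. \<Sum>q'<n. A ! i $$ (p, p') * X ! i $$ (q, q') * u p q * u p' q')"
      by (rule sum.swap)
    also have "\<dots> = (\<Sum>q<n. \<Sum>p<d. \<Sum>q'<n. \<Sum>p'<d. A ! i $$ (p, p') * X ! i $$ (q, q') * u p q * u p' q')"
      by (intro sum.cong refl sum.swap)
    also have "\<dots> = (\<Sum>q<n. \<Sum>q'<n. \<Sum>p<d. \<Sum>p'<d. A ! i $$ (p, p') * X ! i $$ (q, q') * u p q * u p' q')"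
      by (intro sum.cong refl sum.swap)
    also have "\<dots> = (\<Sum>q<n. \<Sum>q'<n. X ! i $$ (q, q') * (v q \<bullet> (A ! i *\<^sub>v v q')))"
    proof (intro sum.cong refl)
      fix q q' assume "q \<in> {..<n}" "q' \<in> {..<n}"
      then have "v q \<in> carrier_vec d" "v q' \<in> carrier_vec d" using v by auto
      then show "(\<Sum>p<d. \<Sum>p'<d. A ! i $$ (p, p') * X ! i $$ (q, q') * u p q * u p' q')
        = X ! i $$ (q, q') * (v q \<bullet> (A ! i *\<^sub>v v q'))"
        using quadratic_form_eq_bil[of "A ! i" d "v q" "v q'"] SM_D(2)[OF A] i
        by (simp add: bil_def u_def sum_distrib_left mult_ac)
    qed
    finally show "(\<Sum>r<d*n. \<Sum>s<d*n. A ! i $$ (r div n, s div n) * X ! i $$ (r mod n, s mod n) * ?u r * ?u s)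
      = (\<Sum>q<n. \<Sum>q'<n. X ! i $$ (q, q') * (v q \<bullet> (A ! i *\<^sub>v v q')))" .
  qed
  finally show ?thesis using SM_D(1)[OF A] by (simp add: pencil_form_def)
qed

lemma psd_pencil_iff:
  assumes A: "A \<in> SM g d" and X: "X \<in> SM g n"
  shows "psd (pencil d n A X) \<longleftrightarrow> (\<forall>v. (\<forall>q<n. v q \<in> carrier_vec d) \<longrightarrow> pencil_form n A X v \<ge> 0)"
proof
  assume "psd (pencil d n A X)"
  then have nonneg: "bil (d * n) (\<lambda>r s. pencil d n A X $$ (r, s)) u u \<ge> 0" for u
    using psd_iff_bil[OF pencil_carrier[OF A X]] by blast
  show "\<forall>v. (\<forall>q<n. v q \<in> carrier_vec d) \<longrightarrow> pencil_form n A X v \<ge> 0"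
  proof (intro allI impI)
    fix v :: "nat \<Rightarrow> real vec"
    assume v: "\<forall>q<n. v q \<in> carrier_vec d"
    show "pencil_form n A X v \<ge> 0"
      by (subst bil_pencil[OF A X, symmetric]) (use v nonneg in auto)
  qed
next
  assume nonneg: "\<forall>v. (\<forall>q<n. v q \<in> carrier_vec d) \<longrightarrow> pencil_form n A X v \<ge> 0"
  let ?P = "\<lambda>r s. pencil d n A X $$ (r, s)"
  have "bil (d * n) ?P u u \<ge> 0" for u
  proof -
    define v where "v = (\<lambda>q. vec d (\<lambda>p. u (p * n + q)))"
    have "bil (d * n) ?P u u = bil (d * n) ?P (\<lambda>r. v (r mod n) $ (r div n)) (\<lambda>r. v (r mod n) $ (r div n))"
      by (auto simp: bil_def v_def dest!: div_mod_less intro!: sum.cong)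
    also have "\<dots> = pencil_form n A X v" by (rule bil_pencil[OF A X]) (simp add: v_def)
    finally show ?thesis using nonneg by (simp add: v_def)
  qed
  moreover have "?P r s = ?P s r" if "r < d * n" "s < d * n" for r s
    using that pencil_index[OF A X] SM_D(4)[OF A] SM_D(4)[OF X]
    by (auto dest!: div_mod_less intro!: sum.cong)
  ultimately show "psd (pencil d n A X)" using psd_iff_bil[OF pencil_carrier[OF A X]] by blast
qed

lemma unitarily_equiv_sym:
  assumes "unitarily_equiv g d A B"
  shows "unitarily_equiv g d B A"
proof -
  from assms obtain U where A: "A \<in> SM g d" and B: "B \<in> SM g d" and U: "U \<in> carrier_mat d d"
    and UU: "U\<^sup>T * U = 1\<^sub>m d" and eq: "\<And>i. i < g \<Longrightarrow> U\<^sup>T * (A ! i) * U = B ! i"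
    unfolding unitarily_equiv_def by auto
  have UT: "U\<^sup>T \<in> carrier_mat d d" using U by simp
  have UU': "U * U\<^sup>T = 1\<^sub>m d" by (rule mat_mult_left_right_inverse[OF UT U UU])
  have "U * (B ! i) * U\<^sup>T = A ! i" if i: "i < g" for i
  proof -
    have Ai: "A ! i \<in> carrier_mat d d" using SM_D(2)[OF A i] .
    have "U * (B ! i) * U\<^sup>T = U * (U\<^sup>T * (A ! i) * U) * U\<^sup>T" using eq[OF i] by simp
    also have "\<dots> = (U * U\<^sup>T) * (A ! i) * (U * U\<^sup>T)" using U UT Ai by (simp add: assoc_mult_mat[of _ d d _ d _ d])
    also have "\<dots> = A ! i" using UU' Ai by simp
    finally show ?thesis .
  qed
  then show ?thesis using A B U UT UU' unfolding unitarily_equiv_def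
    by (intro conjI bexI[of _ "U\<^sup>T"]) auto
qed

text \<open>The form of \<open>U\<^sup>T A U\<close> at a tensor is the form of \<open>A\<close> at the tensor whose slices are multiplied by \<open>U\<close>.\<close>
lemma psd_pencil_unitarily_equiv_imp:
  assumes eqv: "unitarily_equiv g d A B" and X: "X \<in> SM g n" and psd: "psd (pencil d n A X)"
  shows "psd (pencil d n B X)"
proof -
  from eqv obtain U where A: "A \<in> SM g d" and B: "B \<in> SM g d" and U: "U \<in> carrier_mat d d"
    and UU: "U\<^sup>T * U = 1\<^sub>m d" and eq: "\<And>i. i < g \<Longrightarrow> U\<^sup>T * (A ! i) * U = B ! i"
    unfolding unitarily_equiv_def by auto
  have move: "(U *\<^sub>v x) \<bullet> y = x \<bullet> (U\<^sup>T *\<^sub>v y)" if "x \<in> carrier_vec d" "y \<in> carrier_vec d" for x y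
    using transpose_vec_mult_scalar[OF U that] comm_scalar_prod[of "U *\<^sub>v x" d y] comm_scalar_prod[of x d "U\<^sup>T *\<^sub>v y"] U that
    by simp
  show ?thesis unfolding psd_pencil_iff[OF B X]
  proof (intro allI impI)
    fix v :: "nat \<Rightarrow> real vec" assume v: "\<forall>q<n. v q \<in> carrier_vec d"
    let ?w = "\<lambda>q. U *\<^sub>v v q"
    have "?w q \<bullet> ?w q = v q \<bullet> v q" if "q < n" for q
    proof -
      have "?w q \<bullet> ?w q = v q \<bullet> (U\<^sup>T *\<^sub>v (U *\<^sub>v v q))" using that v U by (intro move) auto
      also have "U\<^sup>T *\<^sub>v (U *\<^sub>v v q) = (U\<^sup>T * U) *\<^sub>v v q" using that v U by (intro assoc_mult_mat_vec[symmetric]) auto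
      finally show ?thesis using UU that v by simp
    qed
    moreover have "?w q \<bullet> (A ! i *\<^sub>v ?w q') = v q \<bullet> (B ! i *\<^sub>v v q')" if "q < n" "q' < n" "i < g" for q q' i
    proof -
      have Ai: "A ! i \<in> carrier_mat d d" using SM_D(2)[OF A \<open>i < g\<close>] .
      have vq: "v q \<in> carrier_vec d" "v q' \<in> carrier_vec d" using v that by auto
      have "?w q \<bullet> (A ! i *\<^sub>v ?w q') = v q \<bullet> (U\<^sup>T *\<^sub>v (A ! i *\<^sub>v (U *\<^sub>v v q')))"
        using vq U Ai by (intro move) auto
      also have "U\<^sup>T *\<^sub>v (A ! i *\<^sub>v (U *\<^sub>v v q')) = (U\<^sup>T * (A ! i) * U) *\<^sub>v v q'"
        using vq U Ai by (simp add: assoc_mult_mat_vec[of _ d d _ d])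
      finally show ?thesis using eq \<open>i < g\<close> by simp
    qed
    ultimately have "pencil_form n B X v = pencil_form n A X ?w"
      using SM_D(1)[OF A] SM_D(1)[OF B] by (simp add: pencil_form_def)
    also have "\<dots> \<ge> 0" using psd v U unfolding psd_pencil_iff[OF A X] by (auto intro: mult_mat_vec_carrier)
    finally show "pencil_form n B X v \<ge> 0" .
  qed
qed

lemma psd_pencil_unitarily_equiv:
  assumes "unitarily_equiv g d A B" "X \<in> SM g n"
  shows "psd (pencil d n A X) \<longleftrightarrow> psd (pencil d n B X)"
  using psd_pencil_unitarily_equiv_imp assms unitarily_equiv_sym by blast

text \<open>Splitting every slice into its first \<open>d1\<close> and last \<open>d2\<close> entries splits the form into a sum of two
independent forms.\<close>
lemma psd_pencil_four_block:
  assumes A: "A \<in> SM g d1" and B: "B \<in> SM g d2" and X: "X \<in> SM g n"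
  defines "C \<equiv> map (\<lambda>i. four_block_mat (A ! i) (0\<^sub>m d1 d2) (0\<^sub>m d2 d1) (B ! i)) [0..<g]"
  shows "C \<in> SM g (d1 + d2)"
    and "psd (pencil (d1 + d2) n C X) \<longleftrightarrow> psd (pencil d1 n A X) \<and> psd (pencil d2 n B X)"
proof -
  show C: "C \<in> SM g (d1 + d2)"
  proof (rule SM_I)
    fix i p q assume "i < g" "p < d1 + d2" "q < d1 + d2"
    then show "C ! i $$ (p, q) = C ! i $$ (q, p)"
      using SM_D(4)[OF A \<open>i < g\<close>, of p q] SM_D(4)[OF B \<open>i < g\<close>, of "p - d1" "q - d1"] SM_D(5,6)[OF A \<open>i < g\<close>] SM_D(5,6)[OF B \<open>i < g\<close>]
      by (auto simp: C_def)
  qed (use SM_D(2)[OF A] SM_D(2)[OF B] in \<open>auto simp: C_def\<close>)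
  have form: "pencil_form n C X (\<lambda>q. v q @\<^sub>v w q) = pencil_form n A X v + pencil_form n B X w"
    if v: "\<forall>q<n. v q \<in> carrier_vec d1" and w: "\<forall>q<n. w q \<in> carrier_vec d2" for v w
  proof -
    have "(v q @\<^sub>v w q) \<bullet> (C ! i *\<^sub>v (v q' @\<^sub>v w q')) = v q \<bullet> (A ! i *\<^sub>v v q') + w q \<bullet> (B ! i *\<^sub>v w q')"
      if "i < g" "q < n" "q' < n" for i q q'
    proof -
      have c: "A ! i \<in> carrier_mat d1 d1" "B ! i \<in> carrier_mat d2 d2" "v q \<in> carrier_vec d1" "w q \<in> carrier_vec d2"
        "v q' \<in> carrier_vec d1" "w q' \<in> carrier_vec d2"
        using that v w SM_D(2)[OF A] SM_D(2)[OF B] by auto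
      have "C ! i *\<^sub>v (v q' @\<^sub>v w q') = (A ! i *\<^sub>v v q') @\<^sub>v (B ! i *\<^sub>v w q')"
        using mult_mat_vec_split[OF c(1,2,5,6)] that by (simp add: C_def)
      then show ?thesis using c by (simp add: scalar_prod_append[of _ d1 _ d2])
    qed
    moreover have "(v q @\<^sub>v w q) \<bullet> (v q @\<^sub>v w q) = v q \<bullet> v q + w q \<bullet> w q" if "q < n" for q
      using that v w by (simp add: scalar_prod_append[of _ d1 _ d2])
    ultimately show ?thesis using SM_D(1)[OF A] SM_D(1)[OF B] SM_D(1)[OF C]
      by (simp add: pencil_form_def algebra_simps sum.distrib)
  qed
  have zero: "pencil_form n T X (\<lambda>q. 0\<^sub>v m) = 0" if "T \<in> SM g m" for T m
  proof -
    have "0\<^sub>v m \<bullet> (T ! i *\<^sub>v 0\<^sub>v m) = 0" if "i < g" for i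
      using SM_D(2)[OF \<open>T \<in> SM g m\<close> that] by (intro scalar_prod_left_zero) auto
    then show ?thesis using SM_D(1)[OF that] by (simp add: pencil_form_def)
  qed
  show "psd (pencil (d1 + d2) n C X) \<longleftrightarrow> psd (pencil d1 n A X) \<and> psd (pencil d2 n B X)"
    unfolding psd_pencil_iff[OF A X] psd_pencil_iff[OF B X] psd_pencil_iff[OF C X]
  proof (intro iffI conjI allI impI)
    fix v :: "nat \<Rightarrow> real vec" 
    assume nn: "\<forall>v. (\<forall>q<n. v q \<in> carrier_vec (d1 + d2)) \<longrightarrow> pencil_form n C X v \<ge> 0" and v: "\<forall>q<n. v q \<in> carrier_vec d1"
    have "pencil_form n C X (\<lambda>q. v q @\<^sub>v 0\<^sub>v d2) \<ge> 0" using nn v by auto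
    then show "pencil_form n A X v \<ge> 0" using form[of v "\<lambda>_. 0\<^sub>v d2"] v zero[OF B] by simp
  next
    fix v :: "nat \<Rightarrow> real vec" 
    assume nn: "\<forall>v. (\<forall>q<n. v q \<in> carrier_vec (d1 + d2)) \<longrightarrow> pencil_form n C X v \<ge> 0" and v: "\<forall>q<n. v q \<in> carrier_vec d2"
    have "pencil_form n C X (\<lambda>q. 0\<^sub>v d1 @\<^sub>v v q) \<ge> 0" using nn v by auto
    then show "pencil_form n B X v \<ge> 0" using form[of "\<lambda>_. 0\<^sub>v d1" v] v zero[OF A] by simp
  next
    fix v :: "nat \<Rightarrow> real vec" 
    assume nn: "(\<forall>v. (\<forall>q<n. v q \<in> carrier_vec d1) \<longrightarrow> pencil_form n A X v \<ge> 0) \<and>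
      (\<forall>v. (\<forall>q<n. v q \<in> carrier_vec d2) \<longrightarrow> pencil_form n B X v \<ge> 0)" and v: "\<forall>q<n. v q \<in> carrier_vec (d1 + d2)"
    let ?v1 = "\<lambda>q. vec_first (v q) d1" and ?v2 = "\<lambda>q. vec_last (v q) d2"
    have split: "v q = ?v1 q @\<^sub>v ?v2 q" if "q < n" for q using v that by simp
    have "pencil_form n C X v = pencil_form n C X (\<lambda>q. ?v1 q @\<^sub>v ?v2 q)"
      using split by (simp add: pencil_form_def)
    also have "\<dots> = pencil_form n A X ?v1 + pencil_form n B X ?v2" by (rule form) auto
    also have "\<dots> \<ge> 0" using nn by (auto intro!: add_nonneg_nonneg)
    finally show "pencil_form n C X v \<ge> 0" .
  qed
qed

lemma psd_pencil_diag_blocks: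
  assumes X: "X \<in> SM g n" and "\<forall>j\<in>set js. As j \<in> SM g (ds j)"
  defines "S \<equiv> \<lambda>js. map (\<lambda>i. diag_block_mat (map (\<lambda>j. As j ! i) js)) [0..<g]"
  shows "S js \<in> SM g (sum_list (map ds js)) \<and>
    (psd (pencil (sum_list (map ds js)) n (S js) X) \<longleftrightarrow> (\<forall>j\<in>set js. psd (pencil (ds j) n (As j) X)))"
  using assms(2)
proof (induction js)
  case Nil
  have S: "S [] \<in> SM g 0" by (intro SM_I) (auto simp: S_def)
  have "psd (pencil 0 n (S []) X)" using psd_iff_bil[OF pencil_carrier[OF S X]] by (simp add: bil_def)
  with S show ?case by simp
next
  case (Cons j js)
  let ?d = "sum_list (map ds js)"
  have Aj: "As j \<in> SM g (ds j)" and S: "S js \<in> SM g ?d" using Cons by auto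
  have "S (j # js) = map (\<lambda>i. four_block_mat (As j ! i) (0\<^sub>m (ds j) ?d) (0\<^sub>m ?d (ds j)) (S js ! i)) [0..<g]"
  proof (rule nth_equalityI)
    fix i assume "i < length (S (j # js))"
    then have i: "i < g" by (simp add: S_def)
    have "diag_block_mat (map (\<lambda>j. As j ! i) js) = S js ! i" using i by (simp add: S_def)
    then show "S (j # js) ! i = map (\<lambda>i. four_block_mat (As j ! i) (0\<^sub>m (ds j) ?d) (0\<^sub>m ?d (ds j)) (S js ! i)) [0..<g] ! i"
      using i SM_D(5,6)[OF Aj i] SM_D(5,6)[OF S i] by (simp add: S_def Let_def)
  qed (simp add: S_def)
  with psd_pencil_four_block[OF Aj S X] Cons show ?case by simp
qed

lemma psd_pencil_direct_sum:
  assumes g: "g \<ge> 1" and X: "X \<in> SM g n" and As: "\<forall>j<l. As j \<in> SM g (ds j)"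
    and eqv: "unitarily_equiv g d A (tuple_direct_sum g l As)"
  shows "psd (pencil d n A X) \<longleftrightarrow> (\<forall>j<l. psd (pencil (ds j) n (As j) X))"
proof -
  have S: "tuple_direct_sum g l As \<in> SM g (sum_list (map ds [0..<l]))"
    "psd (pencil (sum_list (map ds [0..<l])) n (tuple_direct_sum g l As) X) \<longleftrightarrow> (\<forall>j<l. psd (pencil (ds j) n (As j) X))"
    using psd_pencil_diag_blocks[OF X, of "[0..<l]" As ds] As by (auto simp: tuple_direct_sum_def)
  have "tuple_direct_sum g l As \<in> SM g d" using eqv by (simp add: unitarily_equiv_def)
  with S(1) g have "sum_list (map ds [0..<l]) = d"
    using SM_D(5)[of _ g d 0] SM_D(5)[of _ g "sum_list (map ds [0..<l])" 0] by fastforce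
  with S(2) psd_pencil_unitarily_equiv[OF eqv X] show ?thesis by simp
qed

section \<open>Linear inequalities as scalar pencils\<close>

text \<open>A point of \<open>\<real>\<^sup>g\<close> as a tuple of matrices of size one. It serves both as a point at level 1 and as the
coefficients of a linear inequality.\<close>
definition scalar_tuple :: "nat \<Rightarrow> (nat \<Rightarrow> real) \<Rightarrow> tuple" where
  "scalar_tuple g x = map (\<lambda>i. mat 1 1 (\<lambda>_. x i)) [0..<g]"

lemma scalar_tuple_SM: "scalar_tuple g x \<in> SM g 1"
  by (intro SM_I) (auto simp: scalar_tuple_def)

lemma diag_block_mat_scalars:
  "diag_block_mat (map (\<lambda>j. mat 1 1 (\<lambda>_. f j)) [0..<m]) = mat m m (\<lambda>(p, q). if p = q then f p else 0)"
proof (induction m)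
  case (Suc m)
  then show ?case by (intro eq_matI) (auto simp: diag_block_mat_last Let_def less_Suc_eq simp del: diag_block_mat.simps)
qed auto

lemma diagonal_tuple_direct_sum:
  assumes D: "D \<in> SM g d" and diag: "\<forall>M\<in>set D. diagonal_mat M"
  shows "tuple_direct_sum g d (\<lambda>j. scalar_tuple g (\<lambda>i. D ! i $$ (j, j))) = D"
proof (rule nth_equalityI)
  fix i assume "i < length (tuple_direct_sum g d (\<lambda>j. scalar_tuple g (\<lambda>i. D ! i $$ (j, j))))"
  then have i: "i < g" by (simp add: tuple_direct_sum_def)
  have "diagonal_mat (D ! i)" using diag i SM_D(1)[OF D] by auto
  then have "mat d d (\<lambda>(p, q). if p = q then D ! i $$ (p, p) else 0) = D ! i"
    using SM_D(5,6)[OF D i] by (intro eq_matI) (auto simp: diagonal_mat_def)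
  moreover have "tuple_direct_sum g d (\<lambda>j. scalar_tuple g (\<lambda>i. D ! i $$ (j, j))) ! i
    = diag_block_mat (map (\<lambda>j. mat 1 1 (\<lambda>_. D ! i $$ (j, j))) [0..<d])"
    using i by (simp add: tuple_direct_sum_def scalar_tuple_def del: One_nat_def)
  ultimately show "tuple_direct_sum g d (\<lambda>j. scalar_tuple g (\<lambda>i. D ! i $$ (j, j))) ! i = D ! i"
    using diag_block_mat_scalars[of "\<lambda>j. D ! i $$ (j, j)" d] by metis
qed (use SM_D(1)[OF D] in \<open>simp add: tuple_direct_sum_def\<close>)

text \<open>A linear inequality with coefficients \<open>b\<close> holds at \<open>Y\<close> if and only if it holds at level 1 for all
compressions of \<open>Y\<close> to one vector.\<close>
lemma psd_scalar_pencil_iff: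
  assumes Y: "Y \<in> SM g m"
  shows "psd (pencil 1 m (scalar_tuple g b) Y) \<longleftrightarrow>
    (\<forall>w. (\<Sum>i<g. b i * bil m (\<lambda>r s. Y ! i $$ (r, s)) w w) \<le> (\<Sum>r<m. (w r)\<^sup>2))"
proof -
  let ?P = "pencil 1 m (scalar_tuple g b) Y"
  have P: "?P \<in> carrier_mat m m" using pencil_carrier[OF scalar_tuple_SM Y] by simp
  have ix: "?P $$ (r, s) = (if s = r then 1 else 0) - (\<Sum>i<g. b i * Y ! i $$ (r, s))" if "r < m" "s < m" for r s
    using pencil_index[OF scalar_tuple_SM Y, of r s b] that by (simp add: scalar_tuple_def)
  have "bil m (\<lambda>r s. ?P $$ (r, s)) w w = (\<Sum>r<m. (w r)\<^sup>2) - (\<Sum>i<g. b i * bil m (\<lambda>r s. Y ! i $$ (r, s)) w w)" for w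
  proof -
    have "bil m (\<lambda>r s. ?P $$ (r, s)) w w = (\<Sum>r<m. \<Sum>s<m. (if s = r then (w r)\<^sup>2 else 0) -
        (\<Sum>i<g. b i * (Y ! i $$ (r, s) * w r * w s)))"
      unfolding bil_def using ix
      by (intro sum.cong refl) (auto simp: power2_eq_square left_diff_distrib right_diff_distrib sum_distrib_left mult_ac)
    then show ?thesis
      by (simp add: bil_def sum_subtractf sum_distrib_left sum.swap[where A = "{..<g}"])
  qed
  moreover have "?P $$ (r, s) = ?P $$ (s, r)" if "r < m" "s < m" for r s
    using ix that SM_D(4)[OF Y] by auto
  ultimately show ?thesis unfolding psd_iff_bil[OF P] by auto
qed

lemma psd_scalar_pencil_scalar_iff:
  "psd (pencil 1 1 (scalar_tuple g b) (scalar_tuple g x)) \<longleftrightarrow> (\<Sum>i<g. b i * x i) \<le> 1"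
proof -
  have "(\<Sum>i<g. b i * bil 1 (\<lambda>r s. scalar_tuple g x ! i $$ (r, s)) w w) = (\<Sum>i<g. b i * x i) * (w 0)\<^sup>2" for w
    by (simp add: bil_def scalar_tuple_def sum_distrib_left sum_distrib_right power2_eq_square mult_ac)
  then have "psd (pencil 1 1 (scalar_tuple g b) (scalar_tuple g x)) \<longleftrightarrow>
      (\<forall>w::nat \<Rightarrow> real. (\<Sum>i<g. b i * x i) * (w 0)\<^sup>2 \<le> (w 0)\<^sup>2)"
    unfolding psd_scalar_pencil_iff[OF scalar_tuple_SM] by simp
  also have "\<dots> \<longleftrightarrow> (\<Sum>i<g. b i * x i) \<le> 1"
  proof
    assume "\<forall>w::nat \<Rightarrow> real. (\<Sum>i<g. b i * x i) * (w 0)\<^sup>2 \<le> (w 0)\<^sup>2"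
    from spec[OF this, of "\<lambda>_. 1"] show "(\<Sum>i<g. b i * x i) \<le> 1" by simp
  next
    assume "(\<Sum>i<g. b i * x i) \<le> 1"
    then show "\<forall>w::nat \<Rightarrow> real. (\<Sum>i<g. b i * x i) * (w 0)\<^sup>2 \<le> (w 0)\<^sup>2"
      using mult_right_mono[of "\<Sum>i<g. b i * x i" 1] by fastforce
  qed
  finally show ?thesis .
qed

section \<open>Facets and joint eigenvectors\<close>

lemma lin_pencil_mult_vec:
  assumes "length A = g" "u \<in> carrier_vec (d * n)" "r < d * n"
  shows "(lin_pencil d n A X *\<^sub>v u) $ r =
    (\<Sum>s<d * n. (\<Sum>i<g. A ! i $$ (r div n, s div n) * X ! i $$ (r mod n, s mod n)) * u $ s)"
  using assms by (simp add: lin_pencil_def scalar_prod_def lessThan_atLeast0)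

lemma pencil_mult_vec:
  assumes "A \<in> SM g d" "X \<in> SM g n" and u: "u \<in> carrier_vec (d * n)"
  shows "pencil d n A X *\<^sub>v u = u - lin_pencil d n A X *\<^sub>v u"
  unfolding pencil_eq[OF assms(1,2)]
  by (subst minus_mult_distrib_mat_vec[OF one_carrier_mat lin_pencil_carrier u]) (use u in simp)

lemma lin_pencil_scalar_mult_vec:
  assumes A: "A \<in> SM g d" and v: "v \<in> carrier_vec d" and r: "r < d"
  shows "(lin_pencil d 1 A (scalar_tuple g x) *\<^sub>v v) $ r = (\<Sum>i<g. x i * (A ! i *\<^sub>v v) $ r)"
proof -
  have "(lin_pencil d 1 A (scalar_tuple g x) *\<^sub>v v) $ r = (\<Sum>s<d. \<Sum>i<g. A ! i $$ (r, s) * x i * v $ s)"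
    using lin_pencil_mult_vec[of A g v d 1 r "scalar_tuple g x"] SM_D(1)[OF A] v r
    by (simp add: scalar_tuple_def sum_distrib_right)
  also have "\<dots> = (\<Sum>i<g. x i * (\<Sum>s<d. A ! i $$ (r, s) * v $ s))"
    by (subst sum.swap) (simp add: sum_distrib_left mult_ac)
  also have "\<dots> = (\<Sum>i<g. x i * (A ! i *\<^sub>v v) $ r)"
    using SM_D(5,6)[OF A] v r by (auto simp: scalar_prod_def lessThan_atLeast0 intro!: sum.cong)
  finally show ?thesis .
qed

lemma shift_scalar_tuple:
  "shift_tuple (scalar_tuple g x) t (scalar_tuple g y) = scalar_tuple g (\<lambda>i. x i + t * y i)"
  by (intro nth_equalityI) (auto simp: shift_tuple_def scalar_tuple_def)

text \<open>Let the level 1 part of the spectrahedron be the polyhedron of the inequalities \<open>b k\<close>, and let \<open>x\<close> lie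
on the facet of \<open>b j\<close> and strictly inside all other inequalities. Beyond \<open>x\<close> on the ray from the origin
the pencil is not positive semidefinite, so at \<open>x\<close> it has a kernel vector \<open>v\<close>. Moving \<open>x\<close> both ways along
a direction \<open>h\<close> within the facet preserves positivity, which forces the linear pencil at \<open>h\<close> to kill \<open>v\<close>.
Thus the linear pencil at \<open>y\<close> maps \<open>v\<close> to a multiple that depends only on the value of \<open>b j\<close> at \<open>y\<close>.\<close>
lemma facet_gives_joint_eigenvector:
  fixes b :: "'j \<Rightarrow> nat \<Rightarrow> real"
  assumes A: "A \<in> SM g d" and J: "finite J" "j \<in> J"
    and polyhedron: "\<And>y. psd (pencil d 1 A (scalar_tuple g y)) \<longleftrightarrow> (\<forall>k\<in>J. (\<Sum>i<g. b k i * y i) \<le> 1)"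
    and on: "(\<Sum>i<g. b j i * x i) = 1" and inside: "\<And>k. k \<in> J \<Longrightarrow> k \<noteq> j \<Longrightarrow> (\<Sum>i<g. b k i * x i) < 1"
  shows "\<exists>v. v \<in> carrier_vec d \<and> v \<noteq> 0\<^sub>v d \<and> (\<forall>i<g. A ! i *\<^sub>v v = b j i \<cdot>\<^sub>v v)"
proof -
  define M where "M = (\<lambda>y. pencil d 1 A (scalar_tuple g y))"
  define L where "L = (\<lambda>y. lin_pencil d 1 A (scalar_tuple g y))"
  define dot where "dot = (\<lambda>k y. \<Sum>i<g. b k i * y i)"
  have Mc: "M y \<in> carrier_mat d d" and Lc: "L y \<in> carrier_mat d d" for y
    using pencil_carrier[OF A scalar_tuple_SM] lin_pencil_carrier[of d 1] by (simp_all add: M_def L_def)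
  have psd_M: "psd (M y) \<longleftrightarrow> (\<forall>k\<in>J. dot k y \<le> 1)" for y using polyhedron by (simp add: M_def dot_def)
  have shift: "M (\<lambda>i. y i + t * z i) = M y + (- t) \<cdot>\<^sub>m L z" for y t z
    using pencil_shift[OF A scalar_tuple_SM scalar_tuple_SM] by (simp add: M_def L_def shift_scalar_tuple)
  have dot_shift: "dot k (\<lambda>i. y i + t * z i) = dot k y + t * dot k z" for k y t z
    by (simp add: dot_def algebra_simps sum.distrib sum_distrib_left)
  have Lv: "(L y *\<^sub>v v) $ r = (\<Sum>i<g. y i * (A ! i *\<^sub>v v) $ r)" if "v \<in> carrier_vec d" "r < d" for y v r
    unfolding L_def by (rule lin_pencil_scalar_mult_vec[OF A that])
  have psd_x: "psd (M x)" unfolding psd_M using on inside by (force simp: dot_def)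
  have "\<exists>v\<in>mat_kernel (M x). v \<noteq> 0\<^sub>v d"
  proof (rule ccontr)
    assume "\<not> ?thesis"
    then have "mat_kernel (M x) \<subseteq> {0\<^sub>v d}" by auto
    moreover have "0\<^sub>v d \<in> mat_kernel (L x)" 
      by (intro mat_kernelI[OF Lc] eq_vecI) (use Lc[of x] in \<open>auto simp: scalar_prod_def\<close>)
    ultimately have "mat_kernel (M x) \<subseteq> mat_kernel (L x)" by auto
    moreover have "(L x)\<^sup>T = L x" unfolding L_def by (rule lin_pencil_sym[OF A scalar_tuple_SM])
    ultimately obtain \<epsilon> where \<epsilon>: "\<epsilon> > 0" "\<And>t. \<bar>t\<bar> \<le> \<epsilon> \<Longrightarrow> psd (M x + t \<cdot>\<^sub>m L x)"
      using psd_perturbation[OF Mc psd_x Lc] by blast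
    have "psd (M (\<lambda>i. x i + \<epsilon> * x i))" unfolding shift using \<epsilon> by simp
    then have "dot j x + \<epsilon> * dot j x \<le> 1" unfolding psd_M dot_shift using J(2) by blast
    then show False using on \<epsilon>(1) by (simp add: dot_def)
  qed
  then obtain v where v: "v \<in> carrier_vec d" "v \<noteq> 0\<^sub>v d" and Mv: "M x *\<^sub>v v = 0\<^sub>v d"
    using mat_kernelD[OF Mc] by metis
  have Lx: "L x *\<^sub>v v = v"
  proof -
    have "M x *\<^sub>v v = v - L x *\<^sub>v v"
      using pencil_mult_vec[OF A scalar_tuple_SM, of v] v by (simp add: M_def L_def)
    then have "v - L x *\<^sub>v v = 0\<^sub>v d" using Mv by simp
    show ?thesis
    proof (rule eq_vecI)
      fix r assume "r < dim_vec v"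
      then have "(v - L x *\<^sub>v v) $ r = v $ r - (L x *\<^sub>v v) $ r" using v Lc[of x] by auto
      then show "(L x *\<^sub>v v) $ r = v $ r" using \<open>v - L x *\<^sub>v v = 0\<^sub>v d\<close> \<open>r < dim_vec v\<close> v by simp
    qed (use v Lc[of x] in auto)
  qed
  have Lh: "L h *\<^sub>v v = 0\<^sub>v d" if h: "dot j h = 0" for h
  proof -
    \<comment> \<open>Small enough to keep the strict inequalities; the summand 1 in the denominator avoids division by zero.\<close>
    define t where "t = Min (insert 1 ((\<lambda>k. (1 - dot k x) / (\<bar>dot k h\<bar> + 1)) ` (J - {j})))"
    have "0 < (1 - dot k x) / (\<bar>dot k h\<bar> + 1)" if "k \<in> J - {j}" for k
      using inside[of k] that by (intro divide_pos_pos) (auto simp: dot_def)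
    then have t0: "t > 0" using J by (auto simp: t_def)
    have small: "t * \<bar>dot k h\<bar> \<le> 1 - dot k x" if k: "k \<in> J" "k \<noteq> j" for k
    proof -
      have "t \<le> (1 - dot k x) / (\<bar>dot k h\<bar> + 1)" using J k by (auto simp: t_def)
      then have "t * (\<bar>dot k h\<bar> + 1) \<le> 1 - dot k x" by (simp add: pos_le_divide_eq)
      then show ?thesis using t0 by (simp add: algebra_simps)
    qed
    have psd_s: "psd (M x + s \<cdot>\<^sub>m L h)" if "\<bar>s\<bar> = t" for s
    proof -
      have "dot k x + - s * dot k h \<le> 1" if "k \<in> J" for k
      proof (cases "k = j")
        case True then show ?thesis using on h by (simp add: dot_def)
      next
        case False
        have "- s * dot k h \<le> \<bar>s\<bar> * \<bar>dot k h\<bar>" by (metis abs_ge_self abs_minus_cancel abs_mult)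
        then show ?thesis using small[OF that False] \<open>\<bar>s\<bar> = t\<close> by simp
      qed
      then have "psd (M (\<lambda>i. x i + - s * h i))" unfolding psd_M dot_shift by blast
      then show ?thesis unfolding shift by simp
    qed
    have mult: "(M x + s \<cdot>\<^sub>m L h) *\<^sub>v v = s \<cdot>\<^sub>v (L h *\<^sub>v v)" for s
    proof -
      have "(M x + s \<cdot>\<^sub>m L h) *\<^sub>v v = M x *\<^sub>v v + (s \<cdot>\<^sub>m L h) *\<^sub>v v"
        using Mc[of x] Lc[of h] v by (intro add_mult_distrib_mat_vec) auto
      also have "\<dots> = s \<cdot>\<^sub>v (L h *\<^sub>v v)" unfolding Mv using Lc[of h] v
        by (intro eq_vecI) (auto simp: scalar_prod_def sum_distrib_left mult_ac)
      finally show ?thesis .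
    qed
    have MLc: "M x + s \<cdot>\<^sub>m L h \<in> carrier_mat d d" for s using Mc[of x] Lc[of h] by auto
    have Lhc: "L h *\<^sub>v v \<in> carrier_vec d" using Lc[of h] v by auto
    have quad: "v \<bullet> ((M x + s \<cdot>\<^sub>m L h) *\<^sub>v v) = s * (v \<bullet> (L h *\<^sub>v v))" for s
      unfolding mult using v Lhc by simp
    have "s * (v \<bullet> (L h *\<^sub>v v)) \<ge> 0" if "\<bar>s\<bar> = t" for s
      using psd_s[OF that] v MLc[of s] unfolding psd_def quad[symmetric] by auto
    from this[of t] this[of "- t"] t0 have z: "v \<bullet> (L h *\<^sub>v v) = 0"
      by (auto simp: zero_le_mult_iff mult_le_0_iff)
    have "(M x + t \<cdot>\<^sub>m L h) *\<^sub>v v = 0\<^sub>v d"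
      by (rule psd_null_vector[OF MLc psd_s v(1)]) (use t0 quad z in auto)
    then have eq: "t \<cdot>\<^sub>v (L h *\<^sub>v v) = 0\<^sub>v d" unfolding mult .
    show ?thesis
    proof (rule eq_vecI)
      fix r assume "r < dim_vec (0\<^sub>v d :: real vec)"
      then have r: "r < d" by simp
      have "(t \<cdot>\<^sub>v (L h *\<^sub>v v)) $ r = 0" using eq r by simp
      then show "(L h *\<^sub>v v) $ r = 0\<^sub>v d $ r" using t0 r carrier_vecD[OF Lhc] by (simp del: index_mult_mat_vec)
    qed (use Lc[of h] in auto)
  qed
  have "A ! i *\<^sub>v v = b j i \<cdot>\<^sub>v v" if i: "i < g" for i
  proof (rule eq_vecI)
    fix r assume "r < dim_vec (b j i \<cdot>\<^sub>v v)"
    then have r: "r < d" using v by simp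
    \<comment> \<open>The \<open>i\<close>-th unit vector, projected along \<open>x\<close> into the facet directions.\<close>
    define h where "h = (\<lambda>k. (if k = i then 1 else 0) - b j i * x k)"
    have split: "(\<Sum>k<g. f k * h k) = f i - b j i * (\<Sum>k<g. f k * x k)" for f :: "nat \<Rightarrow> real"
    proof -
      have "(\<Sum>k<g. f k * h k) = (\<Sum>k<g. (if k = i then f k else 0) - b j i * (f k * x k))"
        by (intro sum.cong) (auto simp: h_def algebra_simps)
      then show ?thesis using i by (simp add: sum_subtractf sum_distrib_left)
    qed
    have "dot j h = 0" unfolding dot_def split on by simp
    then have "0 = (L h *\<^sub>v v) $ r" using Lh r by simp
    also have "\<dots> = (\<Sum>k<g. (A ! k *\<^sub>v v) $ r * h k)" using Lv[OF v(1) r] by (simp add: mult.commute)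
    also have "\<dots> = (A ! i *\<^sub>v v) $ r - b j i * (L x *\<^sub>v v) $ r"
      unfolding split using Lv[OF v(1) r] by (simp add: mult.commute)
    finally show "(A ! i *\<^sub>v v) $ r = (b j i \<cdot>\<^sub>v v) $ r" using Lx r v by simp
  qed (use v SM_D(5)[OF A that] in auto)
  then show ?thesis using v by blast
qed

lemma joint_eigenvectors_orthogonal:
  assumes A: "A \<in> SM g d" and i: "i < g" and u: "u \<in> carrier_vec d" and v: "v \<in> carrier_vec d"
    and eig: "A ! i *\<^sub>v u = \<alpha> \<cdot>\<^sub>v u" "A ! i *\<^sub>v v = \<beta> \<cdot>\<^sub>v v" and ne: "\<alpha> \<noteq> (\<beta> :: real)"
  shows "u \<bullet> v = 0"
proof -
  have "((A ! i)\<^sup>T *\<^sub>v u) \<bullet> v = u \<bullet> (A ! i *\<^sub>v v)"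
    by (rule transpose_vec_mult_scalar[OF SM_D(2)[OF A i] v u])
  then have "\<alpha> * (u \<bullet> v) = \<beta> * (u \<bullet> v)" using SM_D(3)[OF A i] eig u v by simp
  with ne show ?thesis by simp
qed

text \<open>On \<open>v \<otimes> w\<close> the pencil of \<open>A\<close> acts as the identity on \<open>v\<close> times the scalar pencil of \<open>b\<close> on \<open>w\<close>.\<close>
lemma joint_eigenvector_tensor_kernel:
  assumes A: "A \<in> SM g d" and X: "X \<in> SM g n" and v: "v \<in> carrier_vec d"
    and eig: "\<And>i. i < g \<Longrightarrow> A ! i *\<^sub>v v = b i \<cdot>\<^sub>v v"
    and w: "w \<in> mat_kernel (pencil 1 n (scalar_tuple g b) X)"
  shows "vec (d * n) (\<lambda>r. v $ (r div n) * w $ (r mod n)) \<in> mat_kernel (pencil d n A X)"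
proof -
  let ?t = "vec (d * n) (\<lambda>r. v $ (r div n) * w $ (r mod n))"
  let ?S = "pencil 1 n (scalar_tuple g b) X"
  have wc: "w \<in> carrier_vec n" and Sw: "?S *\<^sub>v w = 0\<^sub>v n"
    using mat_kernelD[OF pencil_carrier[OF scalar_tuple_SM X] w] by auto
  have fix_w: "(\<Sum>s<n. (\<Sum>i<g. b i * X ! i $$ (q, s)) * w $ s) = w $ q" if q: "q < n" for q
  proof -
    have "(lin_pencil 1 n (scalar_tuple g b) X *\<^sub>v w) $ q = w $ q"
      using Sw pencil_mult_vec[OF scalar_tuple_SM X, of w b] wc q carrier_matD[OF lin_pencil_carrier[of 1 n "scalar_tuple g b" X]]
      by (simp add: vec_eq_iff del: index_mult_mat_vec)
    then show ?thesis
      using lin_pencil_mult_vec[OF SM_D(1)[OF scalar_tuple_SM[of g b]], of w 1 n q X] wc q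
      by (simp add: scalar_tuple_def)
  qed
  have fix_v: "(\<Sum>s<d. A ! i $$ (p, s) * v $ s) = b i * v $ p" if "i < g" "p < d" for i p
  proof -
    have "(A ! i *\<^sub>v v) $ p = b i * v $ p" using eig that v by simp
    then show ?thesis using that SM_D(5,6)[OF A \<open>i < g\<close>] v by (simp add: scalar_prod_def lessThan_atLeast0)
  qed
  have "lin_pencil d n A X *\<^sub>v ?t = ?t"
  proof (rule eq_vecI)
    fix r assume "r < dim_vec ?t"
    then have r: "r < d * n" by simp
    define p q where "p = r div n" and "q = r mod n"
    have pq: "p < d" "q < n" using div_mod_less[OF r] by (auto simp: p_def q_def)
    have "(lin_pencil d n A X *\<^sub>v ?t) $ r
      = (\<Sum>s<d * n. (\<Sum>i<g. A ! i $$ (p, s div n) * X ! i $$ (q, s mod n)) * (v $ (s div n) * w $ (s mod n)))"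
      using lin_pencil_mult_vec[OF SM_D(1)[OF A], of ?t d n r X] r by (simp add: p_def q_def)
    also have "\<dots> = (\<Sum>p'<d. \<Sum>q'<n. (\<Sum>i<g. A ! i $$ (p, p') * X ! i $$ (q, q')) * (v $ p' * w $ q'))"
      by (rule sum_div_mod)
    also have "\<dots> = (\<Sum>q'<n. \<Sum>p'<d. \<Sum>i<g. A ! i $$ (p, p') * v $ p' * (X ! i $$ (q, q') * w $ q'))"
      by (subst sum.swap) (simp add: sum_distrib_left sum_distrib_right mult_ac)
    also have "\<dots> = (\<Sum>q'<n. \<Sum>i<g. (\<Sum>p'<d. A ! i $$ (p, p') * v $ p') * (X ! i $$ (q, q') * w $ q'))"
      by (rule sum.cong[OF refl], subst sum.swap) (simp add: sum_distrib_right)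
    also have "\<dots> = v $ p * (\<Sum>q'<n. (\<Sum>i<g. b i * X ! i $$ (q, q')) * w $ q')"
      using fix_v pq by (simp add: sum_distrib_left sum_distrib_right mult_ac)
    also have "\<dots> = v $ p * w $ q" using fix_w pq by simp
    finally show "(lin_pencil d n A X *\<^sub>v ?t) $ r = ?t $ r" using r by (simp add: p_def q_def)
  qed (simp add: lin_pencil_def)
  then show ?thesis using pencil_mult_vec[OF A X, of ?t]
    by (intro mat_kernelI[OF pencil_carrier[OF A X]]) auto
qed

text \<open>The tensors of the \<open>v j\<close> with kernel bases of the scalar pencils lie in the kernel of the pencil of \<open>A\<close>.
They are independent: contracting a relation with \<open>v k\<close> isolates the part that belongs to \<open>k\<close>.\<close>
lemma sum_scalar_kernel_dims_le:
  fixes b :: "'j \<Rightarrow> nat \<Rightarrow> real"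
  assumes A: "A \<in> SM g d" and X: "X \<in> SM g n" and J: "finite J"
    and v: "\<And>j. j \<in> J \<Longrightarrow> v j \<in> carrier_vec d" "\<And>j. j \<in> J \<Longrightarrow> v j \<noteq> 0\<^sub>v d"
    and eig: "\<And>j i. j \<in> J \<Longrightarrow> i < g \<Longrightarrow> A ! i *\<^sub>v v j = b j i \<cdot>\<^sub>v v j"
    and orth: "\<And>j k. j \<in> J \<Longrightarrow> k \<in> J \<Longrightarrow> j \<noteq> k \<Longrightarrow> v k \<bullet> v j = 0"
  shows "(\<Sum>j\<in>J. kernel_dim (pencil 1 n (scalar_tuple g (b j)) X)) \<le> kernel_dim (pencil d n A X)"
proof -
  let ?S = "\<lambda>j. pencil 1 n (scalar_tuple g (b j)) X"
  have Sc: "?S j \<in> carrier_mat n n" for j using pencil_carrier[OF scalar_tuple_SM X] by simp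
  have "\<forall>j. \<exists>W. finite W \<and> card W = kernel_dim (?S j) \<and> W \<subseteq> mat_kernel (?S j) \<and>
      (\<forall>c. (\<forall>r<n. (\<Sum>w\<in>W. c w * w $ r) = 0) \<longrightarrow> (\<forall>w\<in>W. c w = 0))"
  proof
    fix j
    from kernel_basis[OF Sc, of j] show "\<exists>W. finite W \<and> card W = kernel_dim (?S j) \<and> W \<subseteq> mat_kernel (?S j) \<and>
      (\<forall>c. (\<forall>r<n. (\<Sum>w\<in>W. c w * w $ r) = 0) \<longrightarrow> (\<forall>w\<in>W. c w = 0))"
      by (elim ex_forward) simp
  qed
  from choice[OF this] obtain W where W0: "\<forall>j. finite (W j) \<and> card (W j) = kernel_dim (?S j) \<and> W j \<subseteq> mat_kernel (?S j) \<and>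
      (\<forall>c. (\<forall>r<n. (\<Sum>w\<in>W j. c w * w $ r) = 0) \<longrightarrow> (\<forall>w\<in>W j. c w = 0))" ..
  have W: "\<And>j. finite (W j)" "\<And>j. card (W j) = kernel_dim (?S j)" "\<And>j. W j \<subseteq> mat_kernel (?S j)"
    and W_indep: "\<And>j c. \<forall>r<n. (\<Sum>w\<in>W j. c w * w $ r) = 0 \<Longrightarrow> \<forall>w\<in>W j. c w = 0"
    using W0 by simp_all
  define T where "T = (\<lambda>(j, w). vec (d * n) (\<lambda>r. v j $ (r div n) * w $ (r mod n)))"
  have "card (Sigma J W) \<le> kernel_dim (pencil d n A X)"
  proof (rule independent_family_card_le_kernel_dim[OF pencil_carrier[OF A X], where w = T])
    show "finite (Sigma J W)" using J W by auto
    show "T jw \<in> mat_kernel (pencil d n A X)" if "jw \<in> Sigma J W" for jw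
      using that W(3) joint_eigenvector_tensor_kernel[OF A X v(1) eig] by (auto simp: T_def)
    fix c assume "\<forall>r<d * n. (\<Sum>jw\<in>Sigma J W. c jw * T jw $ r) = 0"
    then have zero: "(\<Sum>jw\<in>Sigma J W. c jw * T jw $ r) = 0" if "r < d * n" for r using that by blast
    have entry: "(\<Sum>j\<in>J. v j $ p * (\<Sum>w\<in>W j. c (j, w) * w $ q)) = 0" if pq: "p < d" "q < n" for p q
    proof -
      have "p * n + q < Suc p * n" using pq by simp
      also have "\<dots> \<le> d * n" using pq by (intro mult_right_mono) auto
      finally have r: "p * n + q < d * n" .
      have "(\<Sum>j\<in>J. v j $ p * (\<Sum>w\<in>W j. c (j, w) * w $ q)) = (\<Sum>(j, w)\<in>Sigma J W. c (j, w) * (v j $ p * w $ q))"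
        using J W(1) by (simp add: sum.Sigma[symmetric] sum_distrib_left mult_ac)
      also have "\<dots> = (\<Sum>jw\<in>Sigma J W. c jw * T jw $ (p * n + q))"
        using r pq by (intro sum.cong) (auto simp: T_def)
      finally show ?thesis using zero[OF r] by simp
    qed
    show "\<forall>jw\<in>Sigma J W. c jw = 0"
    proof clarify
      fix k w assume k: "k \<in> J" and w: "w \<in> W k"
      have "(\<Sum>w\<in>W k. c (k, w) * w $ q) = 0" if q: "q < n" for q
      proof -
        let ?c = "\<lambda>j. \<Sum>w\<in>W j. c (j, w) * w $ q"
        have "0 = (\<Sum>p<d. v k $ p * (\<Sum>j\<in>J. v j $ p * ?c j))" using entry q by simp
        also have "\<dots> = (\<Sum>j\<in>J. (\<Sum>p<d. v k $ p * v j $ p) * ?c j)"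
          by (simp add: sum_distrib_left sum_distrib_right mult_ac sum.swap[where A = "{..<d}"])
        also have "\<dots> = (\<Sum>j\<in>J. (v k \<bullet> v j) * ?c j)"
          using carrier_vecD[OF v(1)] by (intro sum.cong) (auto simp: scalar_prod_def lessThan_atLeast0)
        also have "\<dots> = (\<Sum>j\<in>J. if j = k then (v k \<bullet> v k) * ?c k else 0)"
          using orth k by (intro sum.cong) auto
        also have "\<dots> = (v k \<bullet> v k) * ?c k" using J k by simp
        finally have "(v k \<bullet> v k) * ?c k = 0" by simp
        moreover have "v k \<bullet> v k \<noteq> 0" using v[OF k] conjugate_square_eq_0_vec[OF v(1)[OF k]] by simp
        ultimately show ?thesis by simp
      qed
      then show "c (k, w) = 0" using W_indep[where j = k and c = "\<lambda>w. c (k, w)"] w by blast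
    qed
  qed
  moreover have "card (Sigma J W) = (\<Sum>j\<in>J. kernel_dim (?S j))"
    using J W(1,2) by (simp add: card_SigmaI)
  ultimately show ?thesis by simp
qed

section \<open>Extreme points of free polytopes\<close>

text \<open>The free spectrahedron of \<open>A\<close> is cut out, at all levels at once, by the linear inequalities \<open>b j\<close>.\<close>
definition scalar_description :: "nat \<Rightarrow> nat \<Rightarrow> tuple \<Rightarrow> 'j set \<Rightarrow> ('j \<Rightarrow> nat \<Rightarrow> real) \<Rightarrow> bool" where
  "scalar_description g d A J b \<longleftrightarrow> (\<forall>m\<ge>1. \<forall>Y\<in>SM g m.
     psd (pencil d m A Y) \<longleftrightarrow> (\<forall>j\<in>J. psd (pencil 1 m (scalar_tuple g (b j)) Y)))"

text \<open>Take a description with the fewest inequalities. Without the inequality \<open>b j\<close> it admits some matrix tuple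
\<open>Y\<close> at which \<open>b j\<close> fails, and it fails already for the compression of \<open>Y\<close> to a suitable vector \<open>w\<close>. Scaling
this compression so that \<open>b j\<close> becomes an equality gives the point \<open>x j\<close>.\<close>
lemma irredundant_scalar_description:
  fixes b :: "'j \<Rightarrow> nat \<Rightarrow> real"
  assumes "finite J0" "scalar_description g d A J0 b"
  shows "\<exists>J x. finite J \<and> scalar_description g d A J b \<and>
    (\<forall>j\<in>J. (\<Sum>i<g. b j i * x j i) = 1 \<and> (\<forall>k\<in>J. k \<noteq> j \<longrightarrow> (\<Sum>i<g. b k i * x j i) < 1))"
proof -
  let ?cover = "\<lambda>J. scalar_description g d A J b"
  from ex_has_least_nat[of "\<lambda>J. finite J \<and> ?cover J" J0 card] assms
  obtain J where J: "finite J" "?cover J" and least: "\<And>J'. finite J' \<Longrightarrow> ?cover J' \<Longrightarrow> card J \<le> card J'"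
    by blast
  have "\<exists>x. (\<Sum>i<g. b j i * x i) = 1 \<and> (\<forall>k\<in>J. k \<noteq> j \<longrightarrow> (\<Sum>i<g. b k i * x i) < 1)" if j: "j \<in> J" for j
  proof -
    have "card (J - {j}) < card J" using J(1) j by (intro psubset_card_mono) auto
    then have "\<not> ?cover (J - {j})" using least[of "J - {j}"] J(1) by auto
    then obtain m Y where mY: "m \<ge> 1" "Y \<in> SM g m" and
      ne: "psd (pencil d m A Y) \<noteq> (\<forall>k\<in>J - {j}. psd (pencil 1 m (scalar_tuple g (b k)) Y))"
      by (auto simp: scalar_description_def)
    moreover have "psd (pencil d m A Y) \<longleftrightarrow> (\<forall>k\<in>J. psd (pencil 1 m (scalar_tuple g (b k)) Y))"
      using J(2) mY by (simp add: scalar_description_def)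
    ultimately have others: "\<And>k. k \<in> J \<Longrightarrow> k \<noteq> j \<Longrightarrow> psd (pencil 1 m (scalar_tuple g (b k)) Y)"
      and fails: "\<not> psd (pencil 1 m (scalar_tuple g (b j)) Y)" by auto
    define \<beta> where "\<beta> = (\<lambda>w i. bil m (\<lambda>r s. Y ! i $$ (r, s)) w w)"
    obtain w where w: "(\<Sum>i<g. b j i * \<beta> w i) > (\<Sum>r<m. (w r)\<^sup>2)"
      using fails unfolding psd_scalar_pencil_iff[OF mY(2)] \<beta>_def by (auto simp: not_le)
    define s where "s = (\<Sum>i<g. b j i * \<beta> w i)"
    have s: "(\<Sum>r<m. (w r)\<^sup>2) < s" using w by (simp add: s_def)
    \<comment> \<open>Scaling by \<open>s\<close>, which exceeds the squared norm of \<open>w\<close>, puts the point on the hyperplane of \<open>b j\<close> and strictly inside the others.\<close>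
    have "(\<Sum>r<m. (w r)\<^sup>2) \<ge> 0" by (intro sum_nonneg) auto
    with s have s0: "s > 0" by simp
    have scale: "(\<Sum>i<g. b k i * (\<beta> w i / s)) = (\<Sum>i<g. b k i * \<beta> w i) / s" for k
      by (simp add: sum_divide_distrib)
    have "(\<Sum>i<g. b k i * (\<beta> w i / s)) < 1" if "k \<in> J" "k \<noteq> j" for k
    proof -
      have "(\<Sum>i<g. b k i * \<beta> w i) \<le> (\<Sum>r<m. (w r)\<^sup>2)"
        using others[OF that] unfolding psd_scalar_pencil_iff[OF mY(2)] \<beta>_def by blast
      with s s0 show ?thesis unfolding scale by simp
    qed
    moreover have "(\<Sum>i<g. b j i * (\<beta> w i / s)) = 1" unfolding scale using s0 by (simp add: s_def)
    ultimately show ?thesis by (intro exI[of _ "\<lambda>i. \<beta> w i / s"]) auto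
  qed
  then have "\<forall>j\<in>J. \<exists>x. (\<Sum>i<g. b j i * x i) = 1 \<and> (\<forall>k\<in>J. k \<noteq> j \<longrightarrow> (\<Sum>i<g. b k i * x i) < 1)" by blast
  from bchoice[OF this] J show ?thesis by blast
qed

lemma free_polytope_scalar_description:
  assumes g: "g \<ge> 1" and poly: "is_free_polytope g (free_spec g d A)"
  shows "\<exists>(d'::nat) b. scalar_description g d A {..<d'} b"
proof -
  from poly obtain d' B where eq: "free_spec g d' B = free_spec g d A" and "simult_diagonalizable g d' B"
    unfolding is_free_polytope_def by blast
  then obtain D where eqv: "unitarily_equiv g d' B D" and diag: "\<forall>M\<in>set D. diagonal_mat M"
    unfolding simult_diagonalizable_def by blast
  have D: "D \<in> SM g d'" using eqv by (simp add: unitarily_equiv_def)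
  define b where "b = (\<lambda>j i. D ! i $$ (j, j))"
  have sum: "tuple_direct_sum g d' (\<lambda>j. scalar_tuple g (b j)) = D"
    unfolding b_def by (rule diagonal_tuple_direct_sum[OF D diag])
  have mem: "Y \<in> free_spec g e C \<longleftrightarrow> psd (pencil e m C Y)" if "m \<ge> 1" "Y \<in> SM g m" for m Y e C
  proof -
    have same: "k = m" if "Y \<in> SM g k" for k
      using SM_D(5)[OF that, of 0] SM_D(5)[OF \<open>Y \<in> SM g m\<close>, of 0] g by simp
    show ?thesis
    proof
      assume "Y \<in> free_spec g e C"
      then obtain k where k: "Y \<in> SM g k" "psd (pencil e k C Y)"
        by (auto simp: free_spec_def free_spec_level_def)
      with same[OF k(1)] show "psd (pencil e m C Y)" by simp
    next
      assume "psd (pencil e m C Y)"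
      then show "Y \<in> free_spec g e C" using that by (auto simp: free_spec_def free_spec_level_def)
    qed
  qed
  have "psd (pencil d m A Y) \<longleftrightarrow> (\<forall>j<d'. psd (pencil 1 m (scalar_tuple g (b j)) Y))"
    if mY: "m \<ge> 1" "Y \<in> SM g m" for m Y
  proof -
    have "psd (pencil d m A Y) \<longleftrightarrow> psd (pencil d' m B Y)" using mem[OF mY] eq by metis
    also have "\<dots> \<longleftrightarrow> (\<forall>j<d'. psd (pencil 1 m (scalar_tuple g (b j)) Y))"
      using psd_pencil_direct_sum[OF g mY(2), of d' "\<lambda>j. scalar_tuple g (b j)" "\<lambda>_. 1" d' B] scalar_tuple_SM sum eqv by simp
    finally show ?thesis .
  qed
  then have "scalar_description g d A {..<d'} b" by (auto simp: scalar_description_def)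
  then show ?thesis by blast
qed

text \<open>For an irredundant description the equation count bounds \<open>g (n + 1) / 2\<close> by the sum of the kernel
dimensions of the scalar pencils. Each inequality has its own joint eigenvector of \<open>A\<close>; distinct
inequalities give distinct eigenvalue tuples, so these vectors are orthogonal and the sum is at most
the kernel dimension of the pencil of \<open>A\<close>.\<close>
lemma free_polytope_extreme_point_bound:
  assumes g: "g \<ge> 1" and n: "n \<ge> 1" and A: "A \<in> SM g d"
    and poly: "is_free_polytope g (free_spec g d A)" and ext: "euclidean_extreme g d A n X"
  shows "real g * (real n + 1) / 2 \<le> real (kernel_dim (pencil d n A X))"
proof -
  obtain d' b where "scalar_description g d A {..<d'::nat} b"
    using free_polytope_scalar_description[OF g poly] by blast
  from irredundant_scalar_description[OF finite_lessThan this]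
  obtain J x where J: "finite J" and "scalar_description g d A J b"
    and on: "\<And>j. j \<in> J \<Longrightarrow> (\<Sum>i<g. b j i * x j i) = 1"
    and inside: "\<And>j k. j \<in> J \<Longrightarrow> k \<in> J \<Longrightarrow> k \<noteq> j \<Longrightarrow> (\<Sum>i<g. b k i * x j i) < 1"
    by blast
  then have cover: "psd (pencil d m A Y) \<longleftrightarrow> (\<forall>j\<in>J. psd (pencil 1 m (scalar_tuple g (b j)) Y))"
    if "m \<ge> 1" "Y \<in> SM g m" for m Y
    using that by (simp add: scalar_description_def)
  have X: "X \<in> SM g n" and psdX: "psd (pencil d n A X)"
    using ext by (simp_all add: euclidean_extreme_def free_spec_level_def)
  have "psd (pencil d 1 A (scalar_tuple g y)) \<longleftrightarrow> (\<forall>k\<in>J. (\<Sum>i<g. b k i * y i) \<le> 1)" for y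
    using cover[OF _ scalar_tuple_SM] psd_scalar_pencil_scalar_iff by simp
  then have "\<forall>j\<in>J. \<exists>v. v \<in> carrier_vec d \<and> v \<noteq> 0\<^sub>v d \<and> (\<forall>i<g. A ! i *\<^sub>v v = b j i \<cdot>\<^sub>v v)"
    by (intro ballI facet_gives_joint_eigenvector[OF A J]) (use on inside in auto)
  from bchoice[OF this] obtain v where
    v: "\<forall>j\<in>J. v j \<in> carrier_vec d \<and> v j \<noteq> 0\<^sub>v d \<and> (\<forall>i<g. A ! i *\<^sub>v v j = b j i \<cdot>\<^sub>v v j)" ..
  have "v k \<bullet> v j = 0" if jk: "j \<in> J" "k \<in> J" "j \<noteq> k" for j k
  proof -
    have "\<exists>i<g. b k i \<noteq> b j i"
    proof (rule ccontr)
      assume "\<not> ?thesis"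
      then have "(\<Sum>i<g. b k i * x j i) = (\<Sum>i<g. b j i * x j i)" by (intro sum.cong) auto
      then show False using on[of j] inside[of j k] jk by simp
    qed
    then obtain i where "i < g" "b k i \<noteq> b j i" by blast
    with v jk show ?thesis using joint_eigenvectors_orthogonal[OF A, of i "v k" "v j" "b k i" "b j i"] by blast
  qed
  then have "(\<Sum>j\<in>J. kernel_dim (pencil 1 n (scalar_tuple g (b j)) X)) \<le> kernel_dim (pencil d n A X)"
    using v by (intro sum_scalar_kernel_dims_le[OF A X J, of v]) auto
  moreover have "real g * (real n + 1) / 2 \<le> (\<Sum>j\<in>J. real 1 * real (kernel_dim (pencil 1 n (scalar_tuple g (b j)) X)))"
    by (rule extreme_point_equation_count[OF n ext J scalar_tuple_SM]) (use cover[OF n] X psdX in blast)+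
  ultimately show ?thesis by (simp flip: of_nat_sum)
qed

section \<open>Bounds for the kernel dimension at a Euclidean extreme point\<close>

theorem theorem2p4:
  fixes g d n :: nat and A X :: "real mat list"
  assumes "g \<ge> 1" and "d \<ge> 1" and "n \<ge> 1"
    and "A \<in> SM g d"
    and "X \<in> free_spec_level g d A n"
  shows "(euclidean_extreme g d A n X \<longrightarrow>
            real g * (real n + 1) / 2 \<le> real d * real (kernel_dim (pencil d n A X)))
       \<and> (is_free_polytope g (free_spec g d A) \<and> euclidean_extreme g d A n X \<longrightarrow>
            real g * (real n + 1) / 2 \<le> real (kernel_dim (pencil d n A X)))
       \<and> (\<forall>(l::nat) (ds :: nat \<Rightarrow> nat) (As :: nat \<Rightarrow> real mat list).
            (\<forall>j<l. As j \<in> SM g (ds j)) \<and>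
            unitarily_equiv g d A (tuple_direct_sum g l As) \<and>
            euclidean_extreme g d A n X \<longrightarrow>
            real g * (real n + 1) / 2
              \<le> (\<Sum>j<l. real (ds j) * real (kernel_dim (pencil (ds j) n (As j) X))))"
proof (intro conjI impI allI)
  assume ext: "euclidean_extreme g d A n X"
  have "psd (pencil d n A X)" using ext by (simp add: euclidean_extreme_def free_spec_level_def)
  then show "real g * (real n + 1) / 2 \<le> real d * real (kernel_dim (pencil d n A X))"
    using extreme_point_equation_count[OF \<open>n \<ge> 1\<close> ext, of "{()}" "\<lambda>_. A" "\<lambda>_. d"] \<open>A \<in> SM g d\<close> by simp
next
  assume "is_free_polytope g (free_spec g d A) \<and> euclidean_extreme g d A n X"
  then show "real g * (real n + 1) / 2 \<le> real (kernel_dim (pencil d n A X))"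
    using free_polytope_extreme_point_bound assms by blast
next
  fix l :: nat and ds :: "nat \<Rightarrow> nat" and As :: "nat \<Rightarrow> real mat list"
  assume *: "(\<forall>j<l. As j \<in> SM g (ds j)) \<and> unitarily_equiv g d A (tuple_direct_sum g l As) \<and>
    euclidean_extreme g d A n X"
  then have As: "\<forall>j<l. As j \<in> SM g (ds j)" and eqv: "unitarily_equiv g d A (tuple_direct_sum g l As)"
    and ext: "euclidean_extreme g d A n X" by auto
  have X: "X \<in> SM g n" "psd (pencil d n A X)" using ext by (simp_all add: euclidean_extreme_def free_spec_level_def)
  note blocks = psd_pencil_direct_sum[OF \<open>g \<ge> 1\<close> _ As eqv]
  show "real g * (real n + 1) / 2 \<le> (\<Sum>j<l. real (ds j) * real (kernel_dim (pencil (ds j) n (As j) X)))"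
  proof (rule extreme_point_equation_count[OF \<open>n \<ge> 1\<close> ext finite_lessThan])
    show "As j \<in> SM g (ds j)" if "j \<in> {..<l}" for j using As that by simp
    show "psd (pencil (ds j) n (As j) X)" if "j \<in> {..<l}" for j using blocks[OF X(1)] X(2) that by simp
    show "psd (pencil d n A Y)" if "Y \<in> SM g n" "\<forall>j\<in>{..<l}. psd (pencil (ds j) n (As j) Y)" for Y
      using blocks[OF that(1)] that(2) by simp
  qed
qed

end
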